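(* Let $g$ be a Riemannian metric on a smooth manifold $Q$, $L(v)=\frac12 g(v,v)$ the corresponding purely kinetic Lagrangian, and $\mathcal{D}$ a distribution on $Q$. Then the spray $\Gamma_{\nabla^{nh}}$ of the nonholonomic connection $\nabla^{nh}$ is the SODE extension $\Gamma^2=\Gamma_L-[\nabla(Q(\mathbf{T}))]^V$ of the nonholonomic vector field $\Gamma_{(L,\mathcal{D})}$, i.e. $$\Gamma_{\nabla^{nh}}=\Gamma_g-[\nabla(Q(\mathbf{T}))]^V,$$ where $\Gamma_g=\Gamma_L$ is the geodesic spray of $g$ and $\nabla$ is the dynamical covariant derivative of $\Gamma_g$.
   Context: All objects are smooth and repeated indices are summed. (The letter $Q$ denotes both the manifold and a projection operator; the meaning is clear from the context.) $\tau:TQ\to Q$ is the tangent bundle; $\mathcal{D}$ has rank $m$ and $n=\dim Q$. $\mathcal{D}^g$ is the $g$-orthogonal complement of $\mathcal{D}$ in $TQ$; $P:TQ\to\mathcal{D}$ and $Q:TQ\to\mathcal{D}^g$ are the orthogonal projections, extended $C^\infty(TQ)$-linearly to the set $\mathcal{X}(\tau)$ of vector fields along $\tau$ (sections of $\tau^*TQ\to TQ$). A frame $\{X_\alpha\}=\{X_a,X_i\}$ on $Q$ is fixed, globally defined, with $\{X_a\}$ spanning $\mathcal{D}$ and $\{X_i\}$ spanning $\mathcal{D}^g$; $[X_\alpha,X_\beta]=R^\gamma_{\alpha\beta}X_\gamma$; quasi-velocities $v^\alpha$ are the functions on $TQ$ with $v_q=v^\alpha X_\alpha(q)$; $\mathcal{C}=\{v^i=0\}$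 is $\mathcal{D}$ viewed as a submanifold of $TQ$. For a vector field $X$ on $Q$, $X^C$ and $X^V$ are the complete and vertical lifts to $TQ$; $X=\xi^\alpha X_\alpha\in\mathcal{X}(\tau)$ has vertical lift $X^V=\xi^\alpha X_\alpha^V$. $\mathbf{T}=v^\alpha X_\alpha$ is the canonical vector field along $\tau$. A SODE is a vector field on $TQ$ of the form $\Gamma=v^\alpha X_\alpha^C+F^\alpha X_\alpha^V$. Its dynamical covariant derivative $\nabla:\mathcal{X}(\tau)\to\mathcal{X}(\tau)$ is the additive operator with $\nabla(fX)=f\nabla X+\Gamma(f)X$ for $f\in C^\infty(TQ)$ and $\nabla X_\alpha=\Gamma^\beta_\alpha X_\beta$, $\Gamma^\beta_\alpha=-\frac12(X_\alpha^V(F^\beta)+v^\gamma R^\beta_{\alpha\gamma})$. $\Gamma_L$ is the unique SODE with $\Gamma_L(X^V(L))-X^C(L)=0$ for all $X\in\mathcal{X}(Q)$; here it is the geodesic spray $\Gamma_g$. The nonholonomic vector field $\Gamma_{(L,\mathcal{D})}$ is the unique vector field on $\mathcal{C}$ of the form $v^aX_a^C+f^aX_a^V$ with $\Gamma_{(L,\mathcal{D})}(X^V(L))-X^C(L)=0$ on $\mathcal{C}$ for all $X\in\mathrm{Sec}(\mathcal{D})$. A SODE $\Gamma$ is a SODE extension of $\Gamma_{(L,\mathcal{D})}$ if $\Gamma|_{\mathcal{C}}=\Gamma_{(L,\mathcal{D})}$ (equivalently, all base integral curves of $\Gamma_{(L,\mathcal{D})}$ are base integral curves of $\Gamma$). With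 $\nabla^g$ the Levi-Civita connection of $g$, the nonholonomic connection is $\nabla^{nh}_XY=P(\nabla^g_XY)+\nabla^g_X(Q(Y))$ for $X,Y\in\mathcal{X}(Q)$. The (quadratic) spray of a linear connection with $\nabla'_{X_\alpha}X_\beta=\tilde\Gamma^\gamma_{\alpha\beta}X_\gamma$ is the SODE $v^\gamma X_\gamma^C-\tilde\Gamma^\gamma_{\alpha\beta}v^\alpha v^\beta X_\gamma^V$. *)

theory Defs
  imports "HOL-Analysis.Analysis"
begin

section \<open>Smooth maps between Euclidean spaces\<close>

fun higher_differentiable_on ::
  "'a::real_normed_vector set \<Rightarrow> ('a \<Rightarrow> 'b::real_normed_vector) \<Rightarrow> nat \<Rightarrow> bool" where
  "higher_differentiable_on S f 0 \<longleftrightarrow> continuous_on S f"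
| "higher_differentiable_on S f (Suc k) \<longleftrightarrow>
     (\<forall>x\<in>S. f differentiable (at x)) \<and>
     (\<forall>v. higher_differentiable_on S (\<lambda>x. frechet_derivative f (at x) v) k)"

text \<open>Only used for open \<open>S\<close>.\<close>

definition smooth_on :: "'a::real_normed_vector set \<Rightarrow> ('a \<Rightarrow> 'b::real_normed_vector) \<Rightarrow> bool" where
  "smooth_on S f \<longleftrightarrow> (\<forall>k. higher_differentiable_on S f k)"

section \<open>Smooth manifolds\<close>

type_synonym ('p, 'e) chart = "'p set \<times> ('p \<Rightarrow> 'e)"

definition points :: "('p, 'e) chart set \<Rightarrow> 'p set" where
  "points A = (\<Union>(U, \<phi>)\<in>A. U)"

text \<open>The manifold is the whole type, whose Hausdorff second countable topology comes from the
  type classes; its dimension is the dimension of the chart space.\<close>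

definition smooth_manifold ::
  "('q::{t2_space, second_countable_topology}, 'e::euclidean_space) chart set \<Rightarrow> bool" where
  "smooth_manifold A \<longleftrightarrow>
     points A = UNIV \<and>
     (\<forall>(U, \<phi>)\<in>A. open U \<and> open (\<phi> ` U) \<and> homeomorphism U (\<phi> ` U) \<phi> (inv_into U \<phi>)) \<and>
     (\<forall>(U, \<phi>)\<in>A. \<forall>(V, \<psi>)\<in>A. smooth_on (\<phi> ` (U \<inter> V)) (\<psi> \<circ> inv_into U \<phi>))"

definition smooth_near ::
  "('p, 'e::euclidean_space) chart set \<Rightarrow> 'p \<Rightarrow> ('p \<Rightarrow> real) \<Rightarrow> bool" where
  "smooth_near A p f \<longleftrightarrow>
     (\<exists>(U, \<phi>)\<in>A. p \<in> U \<and>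
        (\<exists>W. open W \<and> \<phi> p \<in> W \<and> W \<subseteq> \<phi> ` U \<and> smooth_on W (f \<circ> inv_into U \<phi>)))"

definition smooth_fun :: "('p, 'e::euclidean_space) chart set \<Rightarrow> ('p \<Rightarrow> real) \<Rightarrow> bool" where
  "smooth_fun A f \<longleftrightarrow> (\<forall>p\<in>points A. smooth_near A p f)"

text \<open>A tangent vector at \<open>p\<close> is identified with the directional derivative it induces on
  the real functions that are smooth near \<open>p\<close>; the value on all other functions is set to 0, so
  that equality of tangent vectors is equality of functionals, and linear combinations are
  pointwise.\<close>

type_synonym 'p tvec = "('p \<Rightarrow> real) \<Rightarrow> real"
type_synonym 'p vfield = "'p \<Rightarrow> 'p tvec"

definition tangent_space :: "('p, 'e::euclidean_space) chart set \<Rightarrow> 'p \<Rightarrow> 'p tvec set" where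
  "tangent_space A p =
     {v. \<exists>(U, \<phi>)\<in>A. p \<in> U \<and>
        (\<exists>u. v = (\<lambda>f. if smooth_near A p f
                     then frechet_derivative (f \<circ> inv_into U \<phi>) (at (\<phi> p)) u else 0))}"

definition vector_field :: "('p, 'e::euclidean_space) chart set \<Rightarrow> 'p vfield \<Rightarrow> bool" where
  "vector_field A X \<longleftrightarrow>
     (\<forall>p\<in>points A. X p \<in> tangent_space A p) \<and>
     (\<forall>p\<in>points A. \<forall>f. smooth_near A p f \<longrightarrow> smooth_near A p (\<lambda>x. X x f))"

definition lie_bracket ::
  "('p, 'e::euclidean_space) chart set \<Rightarrow> 'p vfield \<Rightarrow> 'p vfield \<Rightarrow> 'p vfield" where
  "lie_bracket A X Y p f =
     (if smooth_near A p f then X p (\<lambda>x. Y x f) - Y p (\<lambda>x. X x f) else 0)"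

section \<open>The tangent bundle\<close>

type_synonym 'q tpoint = "'q \<times> 'q tvec"

definition tangent_bundle :: "('q, 'e::euclidean_space) chart set \<Rightarrow> 'q tpoint set" where
  "tangent_bundle A = {(q, v). q \<in> points A \<and> v \<in> tangent_space A q}"

text \<open>The induced charts \<open>(x, \<dot>x)\<close> of \<open>TQ\<close>, where the fibre coordinates of \<open>v\<close> are \<open>v(x\<^sup>i)\<close>.\<close>

definition tangent_atlas ::
  "('q, 'e::euclidean_space) chart set \<Rightarrow> ('q tpoint, 'e \<times> 'e) chart set" where
  "tangent_atlas A =
     (\<lambda>(U, \<phi>). ({(q, v)\<in>tangent_bundle A. q \<in> U},
                \<lambda>(q, v). (\<phi> q, \<Sum>b\<in>Basis. v (\<lambda>p. \<phi> p \<bullet> b) *\<^sub>R b))) ` A"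

text \<open>The vertical lift of \<open>u \<in> T\<^sub>qQ\<close> to the point \<open>(q, v)\<close>. For a vector field \<open>Y\<close> on \<open>Q\<close>,
  or along the bundle projection, the vertical lift at \<open>w\<close> is that of \<open>Y (fst w)\<close>,
  or \<open>Y w\<close> respectively.\<close>

definition vlift ::
  "('q, 'e::euclidean_space) chart set \<Rightarrow> 'q tvec \<Rightarrow> 'q tpoint vfield" where
  "vlift A u w F =
     (if smooth_near (tangent_atlas A) w F
      then deriv (\<lambda>t. F (fst w, \<lambda>f. snd w f + t * u f)) 0 else 0)"

text \<open>The complete lift, characterised by \<open>X\<^sup>C(f \<circ> \<tau>) = X(f) \<circ> \<tau>\<close> and
  \<open>X\<^sup>C(df) = d(X(f))\<close>, where a one-form on \<open>Q\<close> is read as a fibrewise linear function on \<open>TQ\<close>.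
  In coordinates it is \<open>X\<^sup>i \<partial>/\<partial>x\<^sup>i + \<dot>x\<^sup>j (\<partial>X\<^sup>i/\<partial>x\<^sup>j) \<partial>/\<partial>\<dot>x\<^sup>i\<close>.\<close>

definition clift ::
  "('q, 'e::euclidean_space) chart set \<Rightarrow> 'q vfield \<Rightarrow> 'q tpoint vfield" where
  "clift A X w =
     (THE Z. Z \<in> tangent_space (tangent_atlas A) w \<and>
        (\<forall>f. smooth_near A (fst w) f \<longrightarrow>
           Z (\<lambda>u. f (fst u)) = X (fst w) f \<and>
           Z (\<lambda>u. snd u f) = snd w (\<lambda>p. X p f)))"

section \<open>Frames\<close>

definition frame :: "('q, real ^ 'n) chart set \<Rightarrow> ('n::finite \<Rightarrow> 'q vfield) \<Rightarrow> bool" where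
  "frame A X \<longleftrightarrow>
     (\<forall>\<alpha>. vector_field A (X \<alpha>)) \<and>
     (\<forall>q\<in>points A. \<forall>u\<in>tangent_space A q. \<exists>!c. u = (\<lambda>f. \<Sum>\<alpha>\<in>UNIV. c \<alpha> * X \<alpha> q f))"

definition frame_coeff :: "('n::finite \<Rightarrow> 'q vfield) \<Rightarrow> 'q \<Rightarrow> 'q tvec \<Rightarrow> 'n \<Rightarrow> real" where
  "frame_coeff X q u = (THE c. u = (\<lambda>f. \<Sum>\<alpha>\<in>UNIV. c \<alpha> * X \<alpha> q f))"

definition quasi_velocity :: "('n::finite \<Rightarrow> 'q vfield) \<Rightarrow> 'n \<Rightarrow> 'q tpoint \<Rightarrow> real" where
  "quasi_velocity X \<alpha> w = frame_coeff X (fst w) (snd w) \<alpha>"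

text \<open>\<open>structure_fun A X \<gamma> \<alpha> \<beta>\<close> is \<open>R\<^sup>\<gamma>\<^sub>\<alpha>\<^sub>\<beta>\<close>.\<close>

definition structure_fun ::
  "('q, real ^ 'n) chart set \<Rightarrow> ('n::finite \<Rightarrow> 'q vfield) \<Rightarrow> 'n \<Rightarrow> 'n \<Rightarrow> 'n \<Rightarrow> 'q \<Rightarrow> real" where
  "structure_fun A X \<gamma> \<alpha> \<beta> q = frame_coeff X q (lie_bracket A (X \<alpha>) (X \<beta>) q) \<gamma>"

definition frame_span :: "('n \<Rightarrow> 'q vfield) \<Rightarrow> 'n set \<Rightarrow> 'q \<Rightarrow> 'q tvec set" where
  "frame_span X I q = {\<lambda>f. \<Sum>\<alpha>\<in>I. c \<alpha> * X \<alpha> q f | c. True}"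

section \<open>Riemannian metrics and connections\<close>

type_synonym 'q metric = "'q \<Rightarrow> 'q tvec \<Rightarrow> 'q tvec \<Rightarrow> real"
type_synonym 'q connection = "'q vfield \<Rightarrow> 'q vfield \<Rightarrow> 'q vfield"

definition riemannian_metric ::
  "('q, 'e::euclidean_space) chart set \<Rightarrow> 'q metric \<Rightarrow> bool" where
  "riemannian_metric A g \<longleftrightarrow>
     (\<forall>q\<in>points A. \<forall>u\<in>tangent_space A q. \<forall>v\<in>tangent_space A q.
        g q u v = g q v u \<and>
        (\<forall>w\<in>tangent_space A q. \<forall>a b. g q (\<lambda>f. a * u f + b * v f) w = a * g q u w + b * g q v w) \<and>
        (u \<noteq> (\<lambda>f. 0) \<longrightarrow> g q u u > 0)) \<and>
     (\<forall>X Y. vector_field A X \<longrightarrow> vector_field A Y \<longrightarrow> smooth_fun A (\<lambda>q. g q (X q) (Y q)))"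

definition orth_complement ::
  "('q, 'e::euclidean_space) chart set \<Rightarrow> 'q metric \<Rightarrow> ('q \<Rightarrow> 'q tvec set) \<Rightarrow> 'q \<Rightarrow> 'q tvec set" where
  "orth_complement A g D q = {u\<in>tangent_space A q. \<forall>v\<in>D q. g q u v = 0}"

definition orth_proj ::
  "'q metric \<Rightarrow> ('q \<Rightarrow> 'q tvec set) \<Rightarrow> 'q \<Rightarrow> 'q tvec \<Rightarrow> 'q tvec" where
  "orth_proj g S q u = (THE p. p \<in> S q \<and> (\<forall>s\<in>S q. g q (\<lambda>f. u f - p f) s = 0))"

definition linear_connection ::
  "('q, 'e::euclidean_space) chart set \<Rightarrow> 'q connection \<Rightarrow> bool" where
  "linear_connection A nab \<longleftrightarrow>
     (\<forall>X Y. vector_field A X \<longrightarrow> vector_field A Y \<longrightarrow>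
        vector_field A (nab X Y) \<and>
        (\<forall>Z. vector_field A Z \<longrightarrow>
           nab (\<lambda>q f. X q f + Y q f) Z = (\<lambda>q f. nab X Z q f + nab Y Z q f) \<and>
           nab Z (\<lambda>q f. X q f + Y q f) = (\<lambda>q f. nab Z X q f + nab Z Y q f)) \<and>
        (\<forall>h. smooth_fun A h \<longrightarrow>
           nab (\<lambda>q f. h q * X q f) Y = (\<lambda>q f. h q * nab X Y q f) \<and>
           nab X (\<lambda>q f. h q * Y q f) = (\<lambda>q f. h q * nab X Y q f + X q h * Y q f)))"

definition levi_civita ::
  "('q, 'e::euclidean_space) chart set \<Rightarrow> 'q metric \<Rightarrow> 'q connection \<Rightarrow> bool" where
  "levi_civita A g nab \<longleftrightarrow>
     linear_connection A nab \<and>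
     (\<forall>X Y. vector_field A X \<longrightarrow> vector_field A Y \<longrightarrow>
        (\<lambda>q f. nab X Y q f - nab Y X q f) = lie_bracket A X Y) \<and>
     (\<forall>X Y Z. vector_field A X \<longrightarrow> vector_field A Y \<longrightarrow> vector_field A Z \<longrightarrow>
        (\<forall>q. Z q (\<lambda>p. g p (X p) (Y p)) = g q (nab Z X q) (Y q) + g q (X q) (nab Z Y q)))"

text \<open>\<open>\<nabla>\<^sup>n\<^sup>h\<^sub>X Y = P(\<nabla>\<^sup>g\<^sub>X Y) + \<nabla>\<^sup>g\<^sub>X (Q(Y))\<close>\<close>

definition nonholonomic_connection ::
  "('q, 'e::euclidean_space) chart set \<Rightarrow> 'q metric \<Rightarrow> ('q \<Rightarrow> 'q tvec set) \<Rightarrow> 'q connection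
     \<Rightarrow> 'q connection" where
  "nonholonomic_connection A g D nab X Y =
     (\<lambda>q f. orth_proj g D q (nab X Y q) f +
            nab X (\<lambda>p. orth_proj g (orth_complement A g D) p (Y p)) q f)"

text \<open>The spray of a linear connection, \<open>v\<^sup>\<gamma> X\<^sub>\<gamma>\<^sup>C - \<Gamma>\<^sup>\<gamma>\<^sub>\<alpha>\<^sub>\<beta> v\<^sup>\<alpha> v\<^sup>\<beta> X\<^sub>\<gamma>\<^sup>V\<close>.\<close>

definition spray ::
  "('q, real ^ 'n) chart set \<Rightarrow> ('n::finite \<Rightarrow> 'q vfield) \<Rightarrow> 'q connection \<Rightarrow> 'q tpoint vfield" where
  "spray A X nab w F =
     (\<Sum>\<gamma>\<in>UNIV. quasi_velocity X \<gamma> w * clift A (X \<gamma>) w F) -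
     (\<Sum>\<gamma>\<in>UNIV. \<Sum>\<alpha>\<in>UNIV. \<Sum>\<beta>\<in>UNIV.
        frame_coeff X (fst w) (nab (X \<alpha>) (X \<beta>) (fst w)) \<gamma>
          * quasi_velocity X \<alpha> w * quasi_velocity X \<beta> w * vlift A (X \<gamma> (fst w)) w F)"

section \<open>Second-order vector fields\<close>

definition sode_with ::
  "('q, real ^ 'n) chart set \<Rightarrow> ('n::finite \<Rightarrow> 'q vfield) \<Rightarrow> 'q tpoint vfield
     \<Rightarrow> ('n \<Rightarrow> 'q tpoint \<Rightarrow> real) \<Rightarrow> bool" where
  "sode_with A X \<Gamma> F \<longleftrightarrow>
     vector_field (tangent_atlas A) \<Gamma> \<and>
     (\<forall>\<alpha>. smooth_fun (tangent_atlas A) (F \<alpha>)) \<and>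
     (\<forall>w\<in>tangent_bundle A. \<Gamma> w =
        (\<lambda>f. \<Sum>\<alpha>\<in>UNIV. quasi_velocity X \<alpha> w * clift A (X \<alpha>) w f
                      + F \<alpha> w * vlift A (X \<alpha> (fst w)) w f))"

definition sode ::
  "('q, real ^ 'n) chart set \<Rightarrow> ('n::finite \<Rightarrow> 'q vfield) \<Rightarrow> 'q tpoint vfield \<Rightarrow> bool" where
  "sode A X \<Gamma> \<longleftrightarrow> (\<exists>F. sode_with A X \<Gamma> F)"

definition field_along ::
  "('q, 'e::euclidean_space) chart set \<Rightarrow> ('q tpoint \<Rightarrow> 'q tvec) \<Rightarrow> bool" where
  "field_along A \<xi> \<longleftrightarrow>
     (\<forall>w\<in>tangent_bundle A. \<xi> w \<in> tangent_space A (fst w)) \<and>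
     (\<forall>w\<in>tangent_bundle A. \<forall>f. smooth_near A (fst w) f \<longrightarrow>
        smooth_near (tangent_atlas A) w (\<lambda>u. \<xi> u f))"

definition canonical_field :: "('n::finite \<Rightarrow> 'q vfield) \<Rightarrow> 'q tpoint \<Rightarrow> 'q tvec" where
  "canonical_field X w = (\<lambda>f. \<Sum>\<alpha>\<in>UNIV. quasi_velocity X \<alpha> w * X \<alpha> (fst w) f)"

text \<open>The first clause says that \<open>nab\<close> acts on fields along the bundle projection, which are
  determined by their values on the tangent bundle: values elsewhere are irrelevant.\<close>

definition dynamical_cov_deriv ::
  "('q, real ^ 'n) chart set \<Rightarrow> ('n::finite \<Rightarrow> 'q vfield) \<Rightarrow> 'q tpoint vfield
     \<Rightarrow> (('q tpoint \<Rightarrow> 'q tvec) \<Rightarrow> ('q tpoint \<Rightarrow> 'q tvec)) \<Rightarrow> bool" where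
  "dynamical_cov_deriv A X \<Gamma> nab \<longleftrightarrow>
     (\<forall>\<xi> \<eta>. field_along A \<xi> \<longrightarrow> (\<forall>w\<in>tangent_bundle A. \<xi> w = \<eta> w) \<longrightarrow>
        (\<forall>w\<in>tangent_bundle A. nab \<xi> w = nab \<eta> w)) \<and>
     (\<forall>\<xi>. field_along A \<xi> \<longrightarrow> field_along A (nab \<xi>)) \<and>
     (\<forall>\<xi> \<eta>. field_along A \<xi> \<longrightarrow> field_along A \<eta> \<longrightarrow> (\<forall>w\<in>tangent_bundle A.
        nab (\<lambda>u f. \<xi> u f + \<eta> u f) w = (\<lambda>f. nab \<xi> w f + nab \<eta> w f))) \<and>
     (\<forall>h \<xi>. smooth_fun (tangent_atlas A) h \<longrightarrow> field_along A \<xi> \<longrightarrow> (\<forall>w\<in>tangent_bundle A.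
        nab (\<lambda>u f. h u * \<xi> u f) w = (\<lambda>f. h w * nab \<xi> w f + \<Gamma> w h * \<xi> w f))) \<and>
     (\<exists>F. sode_with A X \<Gamma> F \<and>
        (\<forall>\<alpha>. \<forall>w\<in>tangent_bundle A. nab (\<lambda>u. X \<alpha> (fst u)) w =
           (\<lambda>f. \<Sum>\<beta>\<in>UNIV.
              - (1/2) * (vlift A (X \<alpha> (fst w)) w (F \<beta>)
                  + (\<Sum>\<gamma>\<in>UNIV. quasi_velocity X \<gamma> w * structure_fun A X \<beta> \<alpha> \<gamma> (fst w)))
              * X \<beta> (fst w) f)))"

section \<open>Lagrangian and nonholonomic dynamics\<close>

definition kinetic_lagrangian :: "'q metric \<Rightarrow> 'q tpoint \<Rightarrow> real" where
  "kinetic_lagrangian g w = 1/2 * g (fst w) (snd w) (snd w)"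

definition lagrangian_sode ::
  "('q, real ^ 'n) chart set \<Rightarrow> ('n::finite \<Rightarrow> 'q vfield) \<Rightarrow> ('q tpoint \<Rightarrow> real)
     \<Rightarrow> 'q tpoint vfield \<Rightarrow> bool" where
  "lagrangian_sode A X L \<Gamma> \<longleftrightarrow>
     sode A X \<Gamma> \<and>
     (\<forall>Y. vector_field A Y \<longrightarrow> (\<forall>w\<in>tangent_bundle A.
        \<Gamma> w (\<lambda>u. vlift A (Y (fst u)) u L) - clift A Y w L = 0))"

text \<open>\<open>D\<close> is the distribution of rank \<open>card I\<close> spanned by the \<open>X\<^sub>a\<close> with \<open>a \<in> I\<close>, and the
  remaining frame members span its orthogonal complement.\<close>

definition adapted_frame ::
  "('q, real ^ 'n) chart set \<Rightarrow> 'q metric \<Rightarrow> ('q \<Rightarrow> 'q tvec set) \<Rightarrow> 'n set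
     \<Rightarrow> ('n::finite \<Rightarrow> 'q vfield) \<Rightarrow> bool" where
  "adapted_frame A g D I X \<longleftrightarrow>
     frame A X \<and>
     (\<forall>q\<in>points A. D q = frame_span X I q \<and> orth_complement A g D q = frame_span X (- I) q)"

definition constraint_set ::
  "('q, real ^ 'n) chart set \<Rightarrow> ('n::finite \<Rightarrow> 'q vfield) \<Rightarrow> 'n set \<Rightarrow> 'q tpoint set" where
  "constraint_set A X I = {w\<in>tangent_bundle A. \<forall>i\<in>- I. quasi_velocity X i w = 0}"

text \<open>The constraint set is a closed embedded submanifold of the tangent bundle. Hence its smooth
  functions are the restrictions of smooth functions on the tangent bundle, and a vector field
  along it is tangent to it iff it annihilates the \<open>v\<^sup>i\<close>.\<close>

definition nonholonomic_field ::
  "('q, real ^ 'n) chart set \<Rightarrow> ('n::finite \<Rightarrow> 'q vfield) \<Rightarrow> ('q \<Rightarrow> 'q tvec set) \<Rightarrow> 'n set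
     \<Rightarrow> ('q tpoint \<Rightarrow> real) \<Rightarrow> 'q tpoint vfield \<Rightarrow> bool" where
  "nonholonomic_field A X D I L \<Gamma> \<longleftrightarrow>
     (\<forall>w\<in>constraint_set A X I. \<forall>i\<in>- I. \<Gamma> w (quasi_velocity X i) = 0) \<and>
     (\<exists>F. (\<forall>a\<in>I. \<exists>G. smooth_fun (tangent_atlas A) G \<and> (\<forall>w\<in>constraint_set A X I. F a w = G w)) \<and>
        (\<forall>w\<in>constraint_set A X I. \<Gamma> w =
           (\<lambda>f. \<Sum>a\<in>I. quasi_velocity X a w * clift A (X a) w f
                      + F a w * vlift A (X a (fst w)) w f))) \<and>
     (\<forall>Y. vector_field A Y \<longrightarrow> (\<forall>q\<in>points A. Y q \<in> D q) \<longrightarrow> (\<forall>w\<in>constraint_set A X I.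
        \<Gamma> w (\<lambda>u. vlift A (Y (fst u)) u L) - clift A Y w L = 0))"

definition sode_extension ::
  "('q, real ^ 'n) chart set \<Rightarrow> ('n::finite \<Rightarrow> 'q vfield) \<Rightarrow> 'n set
     \<Rightarrow> 'q tpoint vfield \<Rightarrow> 'q tpoint vfield \<Rightarrow> bool" where
  "sode_extension A X I \<Gamma> \<Gamma>\<^sub>D \<longleftrightarrow>
     sode A X \<Gamma> \<and> (\<forall>w\<in>constraint_set A X I. \<Gamma> w = \<Gamma>\<^sub>D w)"

text \<open>\<open>\<Gamma> - [\<nabla>(Q(T))]\<^sup>V\<close>, where \<open>Q\<close> is the projection onto the orthogonal complement of \<open>D\<close>.\<close>

definition projected_sode ::
  "('q, real ^ 'n) chart set \<Rightarrow> 'q metric \<Rightarrow> ('q \<Rightarrow> 'q tvec set) \<Rightarrow> ('n::finite \<Rightarrow> 'q vfield)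
     \<Rightarrow> 'q tpoint vfield \<Rightarrow> (('q tpoint \<Rightarrow> 'q tvec) \<Rightarrow> ('q tpoint \<Rightarrow> 'q tvec))
     \<Rightarrow> 'q tpoint vfield" where
  "projected_sode A g D X \<Gamma> nab w f =
     \<Gamma> w f - vlift A (nab (\<lambda>u. orth_proj g (orth_complement A g D) (fst u) (canonical_field X u)) w) w f"

end

theory Submission
  imports Defs
begin

text \<open>
  The vector fields to be compared all have the shape \<open>v\<^sup>\<alpha> X\<^sub>\<alpha>\<^sup>C + F\<^sup>\<alpha> X\<^sub>\<alpha>\<^sup>V\<close>, so everything is a question
  about the forces \<open>F\<close>. Write \<open>\<nabla>\<^sub>v v\<close> for \<open>v\<^sup>\<alpha> v\<^sup>\<beta> \<nabla>\<^sup>g\<^sub>\<alpha> X\<^sub>\<beta>\<close>. For a vector \<open>Z\<close> of this shape at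
  \<open>w = (q, v)\<close> the compatibility of \<open>\<nabla>\<^sup>g\<close> with \<open>g\<close> and the vanishing of its torsion give
  (lemma \<open>euler_lagrange\<close>)
  \<open>Z(X\<^sub>\<beta>\<^sup>V L) - X\<^sub>\<beta>\<^sup>C L = g(F\<^sup>\<gamma> X\<^sub>\<gamma> + \<nabla>\<^sub>v v, X\<^sub>\<beta>)\<close>.
  If this vanishes for all \<open>\<beta>\<close>, then \<open>F\<^sup>\<gamma> X\<^sub>\<gamma> = - \<nabla>\<^sub>v v\<close>, which is the geodesic spray. If \<open>v \<in> D\<close>, if \<open>F\<close>
  has components in \<open>D\<close> only and if the expression vanishes for the \<open>X\<^sub>\<beta>\<close> that span \<open>D\<close>, then \<open>F\<close>
  is the orthogonal projection of \<open>- \<nabla>\<^sub>v v\<close> to \<open>D\<close>, which is the nonholonomic field.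

  The forces of the geodesic spray being quadratic in \<open>v\<close>, their vertical derivatives are linear
  combinations of the Christoffel symbols, and in the dynamical covariant derivative the structure
  functions cancel the wrongly ordered ones: \<open>\<nabla>X\<^sub>i = v\<^sup>\<alpha> \<nabla>\<^sup>g\<^sub>\<alpha> X\<^sub>i\<close> (lemma \<open>covariant_frame\<close>). Since
  \<open>Q(T) = v\<^sup>i X\<^sub>i\<close>, summed over the frame members orthogonal to \<open>D\<close>, and \<open>\<Gamma>(v\<^sup>i) = F\<^sup>i\<close>,
  \<open>\<nabla>(Q(T)) = v\<^sup>i v\<^sup>\<alpha> \<nabla>\<^sup>g\<^sub>\<alpha> X\<^sub>i - Q(\<nabla>\<^sub>v v)\<close>.
  Hence the forces of \<open>\<Gamma> - [\<nabla>(Q(T))]\<^sup>V\<close> are \<open>- P(\<nabla>\<^sub>v v) - v\<^sup>\<alpha> v\<^sup>i \<nabla>\<^sup>g\<^sub>\<alpha> X\<^sub>i\<close>. The first term comes from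
  \<open>P(\<nabla>\<^sup>g\<^sub>X Y)\<close> and the second from \<open>\<nabla>\<^sup>g\<^sub>X (Q(Y))\<close>, so this is the spray of the nonholonomic connection.
  Where all \<open>v\<^sup>i\<close> vanish only \<open>- P(\<nabla>\<^sub>v v)\<close> remains, so it extends the nonholonomic field.

  Two points need work on the manifold itself. The quasi-velocities and the coefficients of
  \<open>\<nabla>(Q(T))\<close> must be smooth on the tangent bundle, which follows from Cramer's rule in a chart
  (\<open>smooth_near_frame_coeff\<close>). And the complete lift, a definite description, must exist. For a
  frame field it is built from its prescribed values on the bundle coordinates; that it takes the
  right value on every differential \<open>df\<close> rests on brackets of frame fields being vector fields, which
  the vanishing torsion provides (\<open>clift_frame_exists\<close>). The calculus of smooth functions and
  tangent vectors is developed once for an abstract atlas and used for both \<open>Q\<close> and \<open>TQ\<close>.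
\<close>

section \<open>Smooth maps between Euclidean spaces\<close>

lemma higher_differentiable_on_cong:
  assumes "open S" and "\<And>x. x \<in> S \<Longrightarrow> f x = g x" and "higher_differentiable_on S f k"
  shows "higher_differentiable_on S g k"
  using assms(2,3)
proof (induction k arbitrary: f g)
  case 0
  then show ?case by (simp cong: continuous_on_cong)
next
  case (Suc k)
  have der: "(g has_derivative frechet_derivative f (at x)) (at x)" if "x \<in> S" for x
    using Suc.prems that
    by (auto simp: frechet_derivative_works intro: has_derivative_transform_within_open[OF _ \<open>open S\<close>])
  then have eq: "frechet_derivative g (at x) = frechet_derivative f (at x)" if "x \<in> S" for x
    using that frechet_derivative_at by metis
  have "higher_differentiable_on S (\<lambda>x. frechet_derivative g (at x) v) k" for v
  proof (rule Suc.IH)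
    show "frechet_derivative f (at x) v = frechet_derivative g (at x) v" if "x \<in> S" for x
      using eq[OF that] by simp
    show "higher_differentiable_on S (\<lambda>x. frechet_derivative f (at x) v) k"
      using Suc.prems by simp
  qed
  then show ?case using der by (auto simp: differentiable_def)
qed

text \<open>For building the derivative of a composite expression it is convenient to supply the
  derivative as an explicit formula.\<close>

lemma higher_differentiable_on_SucI:
  assumes "open S" and "\<And>x. x \<in> S \<Longrightarrow> (f has_derivative f' x) (at x)"
    and "\<And>v. higher_differentiable_on S (\<lambda>x. f' x v) k"
  shows "higher_differentiable_on S f (Suc k)"
proof -
  have "frechet_derivative f (at x) = f' x" if "x \<in> S" for x
    using assms(2)[OF that] frechet_derivative_at by metis
  then have "higher_differentiable_on S (\<lambda>x. frechet_derivative f (at x) v) k" for v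
    using higher_differentiable_on_cong[OF assms(1) _ assms(3)[of v]] by simp
  then show ?thesis using assms(2) by (auto simp: differentiable_def)
qed

lemma higher_differentiable_on_Suc_has_derivative:
  assumes "higher_differentiable_on S f (Suc k)" "x \<in> S"
  shows "(f has_derivative frechet_derivative f (at x)) (at x)"
  using assms by (simp add: frechet_derivative_works)

lemma higher_differentiable_on_SucD:
  assumes "open S" "higher_differentiable_on S f (Suc k)"
  shows "higher_differentiable_on S f k"
  using assms(2)
proof (induction k arbitrary: f)
  case 0
  then show ?case
    by (auto simp: continuous_on_eq_continuous_at[OF \<open>open S\<close>] differentiable_imp_continuous_within)
qed auto

lemma higher_differentiable_on_subset:
  assumes "T \<subseteq> S" "higher_differentiable_on S f k"
  shows "higher_differentiable_on T f k"
  using assms(2) by (induction k arbitrary: f) (use assms(1) continuous_on_subset in auto)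

lemma higher_differentiable_on_const:
  "higher_differentiable_on S (\<lambda>x. c) k"
  by (induction k arbitrary: c) auto

lemma higher_differentiable_on_add:
  assumes "open S" "higher_differentiable_on S f k" "higher_differentiable_on S g k"
  shows "higher_differentiable_on S (\<lambda>x. f x + g x) k"
  using assms(2,3)
proof (induction k arbitrary: f g)
  case 0
  then show ?case by (auto intro: continuous_intros)
next
  case (Suc k)
  show ?case
    by (rule higher_differentiable_on_SucI[OF \<open>open S\<close>], rule has_derivative_add)
      (use Suc in \<open>auto simp: frechet_derivative_works\<close>)
qed

lemma higher_differentiable_on_linear_comp:
  assumes "bounded_linear h" "open S" "higher_differentiable_on S f k"
  shows "higher_differentiable_on S (\<lambda>x. h (f x)) k"
  using assms(3)
proof (induction k arbitrary: f)
  case 0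
  then show ?case
    by (auto intro: bounded_linear.continuous_on[OF assms(1)])
next
  case (Suc k)
  show ?case
    by (rule higher_differentiable_on_SucI[OF \<open>open S\<close>], rule bounded_linear.has_derivative[OF assms(1)])
      (use Suc in \<open>auto simp: frechet_derivative_works\<close>)
qed

lemma higher_differentiable_on_scaleR:
  fixes f :: "'a::real_normed_vector \<Rightarrow> real" and g :: "'a \<Rightarrow> 'b::real_normed_vector"
  assumes "open S" "higher_differentiable_on S f k" "higher_differentiable_on S g k"
  shows "higher_differentiable_on S (\<lambda>x. f x *\<^sub>R g x) k"
  using assms(2,3)
proof (induction k arbitrary: f g)
  case 0
  then show ?case by (auto intro: continuous_intros)
next
  case (Suc k)
  note low = higher_differentiable_on_SucD[OF \<open>open S\<close>]
  show ?case
  proof (rule higher_differentiable_on_SucI[OF \<open>open S\<close>])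
    show "((\<lambda>x. f x *\<^sub>R g x) has_derivative
        (\<lambda>v. f x *\<^sub>R frechet_derivative g (at x) v + frechet_derivative f (at x) v *\<^sub>R g x)) (at x)"
      if "x \<in> S" for x
      using Suc.prems[THEN higher_differentiable_on_Suc_has_derivative, OF that]
      by (rule has_derivative_scaleR)
    show "higher_differentiable_on S
        (\<lambda>x. f x *\<^sub>R frechet_derivative g (at x) v + frechet_derivative f (at x) v *\<^sub>R g x) k" for v
      using Suc.prems Suc.IH low[OF Suc.prems(1)] low[OF Suc.prems(2)]
      by (intro higher_differentiable_on_add[OF \<open>open S\<close>]) simp_all
  qed
qed

lemma higher_differentiable_on_inverse:
  fixes f :: "'a::real_normed_vector \<Rightarrow> real"
  assumes "open S" "higher_differentiable_on S f k" "\<And>x. x \<in> S \<Longrightarrow> f x \<noteq> 0"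
  shows "higher_differentiable_on S (\<lambda>x. inverse (f x)) k"
  using assms(2)
proof (induction k)
  case 0
  then show ?case using assms(3) by (auto intro: continuous_intros)
next
  case (Suc k)
  note mult = higher_differentiable_on_scaleR[OF \<open>open S\<close>, where 'b = real, unfolded real_scaleR_def]
  have inv: "higher_differentiable_on S (\<lambda>x. inverse (f x)) k"
    using Suc higher_differentiable_on_SucD[OF \<open>open S\<close>] by blast
  show ?case
  proof (rule higher_differentiable_on_SucI[OF \<open>open S\<close>])
    show "((\<lambda>x. inverse (f x)) has_derivative
        (\<lambda>v. - 1 * (inverse (f x) * frechet_derivative f (at x) v * inverse (f x)))) (at x)" if "x \<in> S" for x
      using Deriv.has_derivative_inverse[OF assms(3)[OF that]
          higher_differentiable_on_Suc_has_derivative[OF Suc.prems that]] by simp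
    show "higher_differentiable_on S
        (\<lambda>x. - 1 * (inverse (f x) * frechet_derivative f (at x) v * inverse (f x))) k" for v
      by (intro mult higher_differentiable_on_const inv) (use Suc.prems in auto)
  qed
qed

lemma higher_differentiable_on_sum:
  assumes "open S" "\<And>i. i \<in> I \<Longrightarrow> higher_differentiable_on S (f i) k"
  shows "higher_differentiable_on S (\<lambda>x. \<Sum>i\<in>I. f i x) k"
  using assms(2)
  by (induction I rule: infinite_finite_induct)
    (auto intro: higher_differentiable_on_const higher_differentiable_on_add[OF assms(1)])

text \<open>The derivative of a composite in direction \<open>v\<close> is a sum of products of a partial derivative of
  the outer map, composed with the inner one, and a component of the derivative of the inner map.
  Both factors have one derivative less, so the order of differentiability is preserved.\<close>

lemma higher_differentiable_on_compose:
  fixes g :: "'a::real_normed_vector \<Rightarrow> 'b::euclidean_space" and f :: "'b \<Rightarrow> 'c::real_normed_vector"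
  assumes "open S" "open T" "g ` S \<subseteq> T"
    and "higher_differentiable_on T f k" "higher_differentiable_on S g k"
  shows "higher_differentiable_on S (\<lambda>x. f (g x)) k"
  using assms(4,5)
proof (induction k arbitrary: f)
  case 0
  then show ?case using continuous_on_compose2 assms(3) by auto
next
  case (Suc k)
  show ?case
  proof (rule higher_differentiable_on_SucI[OF \<open>open S\<close>])
    fix x assume "x \<in> S"
    then have f: "(f has_derivative frechet_derivative f (at (g x))) (at (g x))"
      using Suc.prems(1) assms(3) by (auto simp: frechet_derivative_works)
    have g: "(g has_derivative frechet_derivative g (at x)) (at x)"
      by (rule higher_differentiable_on_Suc_has_derivative[OF Suc.prems(2) \<open>x \<in> S\<close>])
    have expand: "frechet_derivative f (at (g x)) w =
        (\<Sum>b\<in>Basis. (w \<bullet> b) *\<^sub>R frechet_derivative f (at (g x)) b)" for w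
    proof -
      have "frechet_derivative f (at (g x)) w = frechet_derivative f (at (g x)) (\<Sum>b\<in>Basis. (w \<bullet> b) *\<^sub>R b)"
        by (simp only: euclidean_representation)
      also have "\<dots> = (\<Sum>b\<in>Basis. (w \<bullet> b) *\<^sub>R frechet_derivative f (at (g x)) b)"
        by (simp only: linear_sum[OF has_derivative_linear[OF f]]
            linear_scale[OF has_derivative_linear[OF f]])
      finally show ?thesis .
    qed
    show "((\<lambda>x. f (g x)) has_derivative (\<lambda>v. \<Sum>b\<in>Basis.
        (frechet_derivative g (at x) v \<bullet> b) *\<^sub>R frechet_derivative f (at (g x)) b)) (at x)"
      using diff_chain_at[OF g f] unfolding o_def expand[of "frechet_derivative g (at x) _"] .
  next
    fix v
    have g: "higher_differentiable_on S g k"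
      by (rule higher_differentiable_on_SucD[OF \<open>open S\<close> Suc.prems(2)])
    have "higher_differentiable_on S (\<lambda>x. frechet_derivative f (at (g x)) b) k" for b
      by (rule Suc.IH) (use Suc.prems g in auto)
    moreover have "higher_differentiable_on S (\<lambda>x. frechet_derivative g (at x) v \<bullet> b) k" for b
      by (rule higher_differentiable_on_linear_comp[OF bounded_linear_inner_left \<open>open S\<close>])
        (use Suc.prems in simp)
    ultimately show "higher_differentiable_on S (\<lambda>x. \<Sum>b\<in>Basis.
        (frechet_derivative g (at x) v \<bullet> b) *\<^sub>R frechet_derivative f (at (g x)) b) k"
      by (intro higher_differentiable_on_sum higher_differentiable_on_scaleR \<open>open S\<close>)
  qed
qed

lemma smooth_on_cong:
  assumes "open S" "smooth_on S f" "\<And>x. x \<in> S \<Longrightarrow> f x = g x"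
  shows "smooth_on S g"
  using assms(2) higher_differentiable_on_cong[OF assms(1,3)] by (simp add: smooth_on_def)

lemma smooth_on_subset: "smooth_on S f \<Longrightarrow> T \<subseteq> S \<Longrightarrow> smooth_on T f"
  by (simp add: smooth_on_def higher_differentiable_on_subset[of T S])

lemma smooth_on_imp_has_derivative:
  "smooth_on S f \<Longrightarrow> x \<in> S \<Longrightarrow> (f has_derivative frechet_derivative f (at x)) (at x)"
  using higher_differentiable_on_Suc_has_derivative[of S f 0 x] unfolding smooth_on_def by blast

lemma smooth_on_frechet_derivative:
  "smooth_on S f \<Longrightarrow> smooth_on S (\<lambda>x. frechet_derivative f (at x) v)"
  unfolding smooth_on_def by (metis higher_differentiable_on.simps(2))

lemma smooth_on_const: "smooth_on S (\<lambda>x. c)"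
  by (simp add: smooth_on_def higher_differentiable_on_const)

lemma smooth_on_add: "open S \<Longrightarrow> smooth_on S f \<Longrightarrow> smooth_on S g \<Longrightarrow> smooth_on S (\<lambda>x. f x + g x)"
  by (simp add: smooth_on_def higher_differentiable_on_add)

lemma smooth_on_scaleR:
  fixes f :: "'a::real_normed_vector \<Rightarrow> real"
  shows "open S \<Longrightarrow> smooth_on S f \<Longrightarrow> smooth_on S g \<Longrightarrow> smooth_on S (\<lambda>x. f x *\<^sub>R g x)"
  by (simp add: smooth_on_def higher_differentiable_on_scaleR)

lemma smooth_on_mult:
  fixes f g :: "'a::real_normed_vector \<Rightarrow> real"
  shows "open S \<Longrightarrow> smooth_on S f \<Longrightarrow> smooth_on S g \<Longrightarrow> smooth_on S (\<lambda>x. f x * g x)"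
  using smooth_on_scaleR[of S f g] by simp

lemma smooth_on_inverse:
  fixes f :: "'a::real_normed_vector \<Rightarrow> real"
  shows "open S \<Longrightarrow> smooth_on S f \<Longrightarrow> (\<And>x. x \<in> S \<Longrightarrow> f x \<noteq> 0) \<Longrightarrow> smooth_on S (\<lambda>x. inverse (f x))"
  by (simp add: smooth_on_def higher_differentiable_on_inverse)

lemma smooth_on_sum:
  "open S \<Longrightarrow> (\<And>i. i \<in> I \<Longrightarrow> smooth_on S (f i)) \<Longrightarrow> smooth_on S (\<lambda>x. \<Sum>i\<in>I. f i x)"
  by (simp add: smooth_on_def higher_differentiable_on_sum)

lemma smooth_on_linear_comp:
  "bounded_linear h \<Longrightarrow> open S \<Longrightarrow> smooth_on S f \<Longrightarrow> smooth_on S (\<lambda>x. h (f x))"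
  by (simp add: smooth_on_def higher_differentiable_on_linear_comp)

lemma smooth_on_compose:
  fixes g :: "'a::real_normed_vector \<Rightarrow> 'b::euclidean_space"
  shows "open S \<Longrightarrow> open T \<Longrightarrow> g ` S \<subseteq> T \<Longrightarrow> smooth_on T f \<Longrightarrow> smooth_on S g \<Longrightarrow>
    smooth_on S (\<lambda>x. f (g x))"
  by (simp add: smooth_on_def higher_differentiable_on_compose[of S T g f])

lemma smooth_on_ident: 
  fixes S :: "'a::real_normed_vector set"
  assumes "open S" shows "smooth_on S (\<lambda>x. x)"
proof -
  have "higher_differentiable_on S (\<lambda>x. x) k" for k
    using assms by (cases k) (auto intro: higher_differentiable_on_const)
  then show ?thesis by (simp add: smooth_on_def)
qed

lemma smooth_on_linear: "bounded_linear h \<Longrightarrow> open S \<Longrightarrow> smooth_on S h"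
  by (rule smooth_on_linear_comp[where f = "\<lambda>x. x"]) (simp_all add: smooth_on_ident)

lemma smooth_on_imp_continuous_on: "smooth_on S f \<Longrightarrow> continuous_on S f"
  unfolding smooth_on_def using higher_differentiable_on.simps(1)[of S f] by blast

lemma smooth_on_Pair:
  assumes "open S" "smooth_on S f" "smooth_on S g"
  shows "smooth_on S (\<lambda>x. (f x, g x))"
proof -
  have "smooth_on S (\<lambda>x. (f x, 0) + (0, g x))"
    by (intro smooth_on_add assms(1)
        smooth_on_linear_comp[OF bounded_linear_Pair[OF bounded_linear_ident bounded_linear_zero] assms(1,2)]
        smooth_on_linear_comp[OF bounded_linear_Pair[OF bounded_linear_zero bounded_linear_ident] assms(1,3)])
  then show ?thesis by simp
qed

text \<open>In tangent bundle coordinates the differential of a function is \<open>(x, y) \<mapsto> \<Sum>\<^sub>c y\<^sup>c \<partial>\<^sub>cr(x)\<close>.\<close>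

lemma smooth_on_differential:
  fixes r :: "'e::euclidean_space \<Rightarrow> real"
  assumes "open S" "smooth_on S r"
  shows "smooth_on (S \<times> UNIV) (\<lambda>z. frechet_derivative r (at (fst z)) (snd z))"
proof -
  have op: "open (S \<times> (UNIV :: 'e set))" using assms(1) by (simp add: open_Times)
  have "smooth_on (S \<times> (UNIV :: 'e set)) (\<lambda>z. \<Sum>c\<in>Basis. (snd z \<bullet> c) * frechet_derivative r (at (fst z)) c)"
    by (intro smooth_on_sum smooth_on_mult op
        smooth_on_compose[OF op assms(1) _ smooth_on_frechet_derivative[OF assms(2)]]
        smooth_on_linear_comp[OF bounded_linear_inner_left op] smooth_on_linear
        bounded_linear_fst bounded_linear_snd) auto
  then show ?thesis
  proof (rule smooth_on_cong[OF op])
    fix z :: "'e \<times> 'e" assume "z \<in> S \<times> UNIV"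
    then have lin: "linear (frechet_derivative r (at (fst z)))"
      using smooth_on_imp_has_derivative[OF assms(2)] has_derivative_linear by fastforce
    have "frechet_derivative r (at (fst z)) (snd z) =
        frechet_derivative r (at (fst z)) (\<Sum>c\<in>Basis. (snd z \<bullet> c) *\<^sub>R c)"
      by (simp only: euclidean_representation)
    then show "(\<Sum>c\<in>Basis. (snd z \<bullet> c) * frechet_derivative r (at (fst z)) c) =
        frechet_derivative r (at (fst z)) (snd z)"
      by (simp only: linear_sum[OF lin] linear_scale[OF lin] real_scaleR_def)
  qed
qed

section \<open>Smooth functions and tangent vectors in an atlas\<close>

text \<open>All conditions are on the images of the charts. This makes the theory applicable to the
  tangent bundle as well, whose points are pairs of a point and a functional.\<close>
locale smooth_atlas =
  fixes A :: "('p, 'e::euclidean_space) chart set"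
  assumes chart_inj: "(U, \<phi>) \<in> A \<Longrightarrow> inj_on \<phi> U"
    and chart_overlap_open: "(U, \<phi>) \<in> A \<Longrightarrow> (V, \<psi>) \<in> A \<Longrightarrow> open (\<phi> ` (U \<inter> V))"
    and chart_change_smooth:
      "(U, \<phi>) \<in> A \<Longrightarrow> (V, \<psi>) \<in> A \<Longrightarrow> smooth_on (\<phi> ` (U \<inter> V)) (\<psi> \<circ> inv_into U \<phi>)"
begin

lemma chart_open: "(U, \<phi>) \<in> A \<Longrightarrow> open (\<phi> ` U)"
  using chart_overlap_open[of U \<phi> U \<phi>] by simp

lemma chart_inv: "(U, \<phi>) \<in> A \<Longrightarrow> x \<in> U \<Longrightarrow> inv_into U \<phi> (\<phi> x) = x"
  using chart_inj inv_into_f_f by metis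

lemma pointsI: "(U, \<phi>) \<in> A \<Longrightarrow> x \<in> U \<Longrightarrow> x \<in> points A"
  by (force simp: points_def)

lemma points_chartE:
  assumes "p \<in> points A"
  obtains U \<phi> where "(U, \<phi>) \<in> A" "p \<in> U"
  using assms by (force simp: points_def)

text \<open>Smoothness passes from one chart to another by composition with the change of coordinates.\<close>

lemma smooth_on_change_chart:
  assumes "(U, \<phi>) \<in> A" "(V, \<psi>) \<in> A" "p \<in> U" "p \<in> V"
    and "open W" "\<phi> p \<in> W" "W \<subseteq> \<phi> ` U" "smooth_on W (f \<circ> inv_into U \<phi>)"
  shows "\<exists>W'. open W' \<and> \<psi> p \<in> W' \<and> W' \<subseteq> \<psi> ` V \<and> smooth_on W' (f \<circ> inv_into V \<psi>)"
proof -
  define T where "T = \<phi> \<circ> inv_into V \<psi>"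
  define S where "S = \<psi> ` (V \<inter> U)"
  have "open S" and T: "smooth_on S T"
    using chart_overlap_open chart_change_smooth assms(1,2) by (auto simp: S_def T_def)
  have T_eq: "T (\<psi> x) = \<phi> x" if "x \<in> V" for x
    using chart_inv[OF assms(2) that] by (simp add: T_def)
  define W' where "W' = S \<inter> T -` W"
  have W': "open W'"
    unfolding W'_def
    by (intro continuous_open_preimage smooth_on_imp_continuous_on T \<open>open S\<close> \<open>open W\<close>)
  have "smooth_on W' (\<lambda>y. (f \<circ> inv_into U \<phi>) (T y))"
    by (rule smooth_on_compose[OF W' \<open>open W\<close>])
      (use assms(8) smooth_on_subset[OF T] in \<open>auto simp: W'_def o_def\<close>)
  then have "smooth_on W' (f \<circ> inv_into V \<psi>)"
    by (rule smooth_on_cong[OF W'])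
      (auto simp: W'_def S_def T_eq chart_inv[OF assms(1)] chart_inv[OF assms(2)])
  moreover have "\<psi> p \<in> W'" "W' \<subseteq> \<psi> ` V"
    using assms(3,4,6) by (auto simp: W'_def S_def T_eq)
  ultimately show ?thesis using W' by blast
qed

lemma smooth_near_chart_iff:
  assumes "(U, \<phi>) \<in> A" "p \<in> U"
  shows "smooth_near A p f \<longleftrightarrow>
    (\<exists>W. open W \<and> \<phi> p \<in> W \<and> W \<subseteq> \<phi> ` U \<and> smooth_on W (f \<circ> inv_into U \<phi>))"
proof
  assume "smooth_near A p f"
  then obtain V \<psi> W where "(V, \<psi>) \<in> A" "p \<in> V" "open W" "\<psi> p \<in> W" "W \<subseteq> \<psi> ` V"
      "smooth_on W (f \<circ> inv_into V \<psi>)"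
    by (auto simp: smooth_near_def)
  then show "\<exists>W. open W \<and> \<phi> p \<in> W \<and> W \<subseteq> \<phi> ` U \<and> smooth_on W (f \<circ> inv_into U \<phi>)"
    using smooth_on_change_chart[of V \<psi> U \<phi> p W f] assms by blast
qed (use assms in \<open>auto simp: smooth_near_def\<close>)

lemma smooth_nearE:
  assumes "smooth_near A p f" "(U, \<phi>) \<in> A" "p \<in> U"
  obtains W where "open W" "\<phi> p \<in> W" "W \<subseteq> \<phi> ` U" "smooth_on W (f \<circ> inv_into U \<phi>)"
  using assms(1) smooth_near_chart_iff[OF assms(2,3), of f] by blast

lemma smooth_nearI:
  assumes "(U, \<phi>) \<in> A" "p \<in> U" "open W" "\<phi> p \<in> W" "W \<subseteq> \<phi> ` U" "smooth_on W h"
    and "\<And>x. x \<in> U \<Longrightarrow> \<phi> x \<in> W \<Longrightarrow> f x = h (\<phi> x)"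
  shows "smooth_near A p f"
proof -
  have "smooth_on W (f \<circ> inv_into U \<phi>)"
  proof (rule smooth_on_cong[OF assms(3,6)])
    fix y assume "y \<in> W"
    then obtain x where "x \<in> U" "y = \<phi> x" using assms(5) by blast
    then show "h y = (f \<circ> inv_into U \<phi>) y"
      using \<open>y \<in> W\<close> assms(7) chart_inv[OF assms(1)] by simp
  qed
  then show ?thesis using smooth_near_chart_iff[OF assms(1,2)] assms(3-5) by blast
qed

lemma smooth_near_points: "smooth_near A p f \<Longrightarrow> p \<in> points A"
  by (auto simp: smooth_near_def points_def)

lemma smooth_near_cong_open:
  assumes "(U, \<phi>) \<in> A" "p \<in> U" "open W" "\<phi> p \<in> W"
    and "\<And>x. x \<in> U \<Longrightarrow> \<phi> x \<in> W \<Longrightarrow> f x = g x" and "smooth_near A p f"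
  shows "smooth_near A p g"
proof -
  obtain W' where W': "open W'" "\<phi> p \<in> W'" "W' \<subseteq> \<phi> ` U" "smooth_on W' (f \<circ> inv_into U \<phi>)"
    by (rule smooth_nearE[OF assms(6,1,2)])
  have "smooth_on (W \<inter> W') (f \<circ> inv_into U \<phi>)"
    by (rule smooth_on_subset[OF W'(4)]) auto
  then show ?thesis
    by (rule smooth_nearI[OF assms(1,2) open_Int[OF assms(3) W'(1)], rotated 2])
      (use assms(4,5) W' in \<open>auto simp: chart_inv[OF assms(1)]\<close>)
qed

lemma smooth_near_cong_chart:
  assumes "(U, \<phi>) \<in> A" "p \<in> U" "\<And>x. x \<in> U \<Longrightarrow> f x = g x" "smooth_near A p f"
  shows "smooth_near A p g"
  by (rule smooth_near_cong_open[OF assms(1,2) open_UNIV _ _ assms(4)]) (use assms(3) in auto)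

lemma smooth_near_cong:
  assumes "\<And>x. x \<in> points A \<Longrightarrow> f x = g x" "smooth_near A p f"
  shows "smooth_near A p g"
proof -
  obtain U \<phi> where "(U, \<phi>) \<in> A" "p \<in> U"
    by (rule points_chartE[OF smooth_near_points[OF assms(2)]])
  then show ?thesis
    using smooth_near_cong_chart[of U \<phi> p f g] assms pointsI by blast
qed

lemma smooth_near_binary:
  assumes "smooth_near A p f" "smooth_near A p g"
    and "\<And>S f g :: 'e \<Rightarrow> real. open S \<Longrightarrow> smooth_on S f \<Longrightarrow> smooth_on S g \<Longrightarrow> smooth_on S (\<lambda>x. op (f x) (g x))"
  shows "smooth_near A p (\<lambda>x. op (f x) (g x))"
proof -
  obtain U \<phi> where c: "(U, \<phi>) \<in> A" "p \<in> U"
    by (rule points_chartE[OF smooth_near_points[OF assms(1)]])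
  obtain W where W: "open W" "\<phi> p \<in> W" "W \<subseteq> \<phi> ` U" "smooth_on W (f \<circ> inv_into U \<phi>)"
    by (rule smooth_nearE[OF assms(1) c])
  obtain W' where W': "open W'" "\<phi> p \<in> W'" "W' \<subseteq> \<phi> ` U" "smooth_on W' (g \<circ> inv_into U \<phi>)"
    by (rule smooth_nearE[OF assms(2) c])
  have "open (W \<inter> W')" using W W' by blast
  then have "smooth_on (W \<inter> W') (\<lambda>x. op ((f \<circ> inv_into U \<phi>) x) ((g \<circ> inv_into U \<phi>) x))"
    by (intro assms(3) smooth_on_subset[OF W(4)] smooth_on_subset[OF W'(4)]) auto
  then show ?thesis
    by (rule smooth_nearI[OF c \<open>open (W \<inter> W')\<close>, rotated 2])
      (use W W' in \<open>auto simp: chart_inv[OF c(1)]\<close>)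
qed

lemma smooth_near_add:
  "smooth_near A p f \<Longrightarrow> smooth_near A p g \<Longrightarrow> smooth_near A p (\<lambda>x. f x + g x)"
  by (rule smooth_near_binary) (auto intro: smooth_on_add)

lemma smooth_near_mult:
  "smooth_near A p f \<Longrightarrow> smooth_near A p g \<Longrightarrow> smooth_near A p (\<lambda>x. f x * g x)"
  by (rule smooth_near_binary) (auto intro: smooth_on_mult)

lemma smooth_near_const: "p \<in> points A \<Longrightarrow> smooth_near A p (\<lambda>x. c)"
  by (erule points_chartE, rule smooth_nearI[where W = "_ ` _", OF _ _ chart_open])
    (auto intro: smooth_on_const)

lemma smooth_near_diff:
  "smooth_near A p f \<Longrightarrow> smooth_near A p g \<Longrightarrow> smooth_near A p (\<lambda>x. f x - g x)"
  using smooth_near_add[of p f "\<lambda>x. (-1) * g x"] smooth_near_mult[of p "\<lambda>x. -1" g]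
    smooth_near_const[OF smooth_near_points] by simp

lemma smooth_near_sum:
  "p \<in> points A \<Longrightarrow> (\<And>i. i \<in> J \<Longrightarrow> smooth_near A p (f i)) \<Longrightarrow> smooth_near A p (\<lambda>x. \<Sum>i\<in>J. f i x)"
  by (induction J rule: infinite_finite_induct) (auto intro: smooth_near_const smooth_near_add)

lemma smooth_near_prod:
  "p \<in> points A \<Longrightarrow> (\<And>i. i \<in> J \<Longrightarrow> smooth_near A p (f i)) \<Longrightarrow> smooth_near A p (\<lambda>x. \<Prod>i\<in>J. f i x)"
  by (induction J rule: infinite_finite_induct) (auto intro: smooth_near_const smooth_near_mult)

lemma smooth_near_inverse:
  assumes "smooth_near A p f" "f p \<noteq> 0"
  shows "smooth_near A p (\<lambda>x. inverse (f x))"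
proof -
  obtain U \<phi> where c: "(U, \<phi>) \<in> A" "p \<in> U"
    by (rule points_chartE[OF smooth_near_points[OF assms(1)]])
  define r where "r = f \<circ> inv_into U \<phi>"
  obtain W where W: "open W" "\<phi> p \<in> W" "W \<subseteq> \<phi> ` U" "smooth_on W r"
    unfolding r_def by (rule smooth_nearE[OF assms(1) c])
  define W' where "W' = W \<inter> r -` (- {0})"
  have W': "open W'"
    unfolding W'_def by (intro continuous_open_preimage smooth_on_imp_continuous_on W) auto
  have "smooth_on W' (\<lambda>x. inverse (r x))"
    by (rule smooth_on_inverse[OF W']) (use smooth_on_subset[OF W(4)] in \<open>auto simp: W'_def\<close>)
  then show ?thesis
    by (rule smooth_nearI[OF c W', rotated 2])
      (use W assms(2) in \<open>auto simp: W'_def r_def chart_inv[OF c(1)] chart_inv[OF c]\<close>)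
qed

lemma smooth_near_det:
  fixes M :: "'p \<Rightarrow> real ^ 'n ^ 'n"
  assumes "p \<in> points A" "\<And>i j. smooth_near A p (\<lambda>x. M x $ i $ j)"
  shows "smooth_near A p (\<lambda>x. det (M x))"
  unfolding det_def using assms
  by (intro smooth_near_sum smooth_near_mult smooth_near_const smooth_near_prod)

lemma smooth_near_coordinate:
  assumes "(U, \<phi>) \<in> A" "p \<in> U"
  shows "smooth_near A p (\<lambda>x. \<phi> x \<bullet> b)"
  by (rule smooth_nearI[OF assms chart_open[OF assms(1)], where h = "\<lambda>y. y \<bullet> b"])
    (use assms chart_open[OF assms(1)] in \<open>auto intro: smooth_on_linear bounded_linear_inner_left\<close>)

subsection \<open>Tangent vectors in a chart\<close>

definition chart_vector where
  "chart_vector U \<phi> p u =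
     (\<lambda>f. if smooth_near A p f then frechet_derivative (f \<circ> inv_into U \<phi>) (at (\<phi> p)) u else 0)"

lemma chart_rep_has_derivative:
  assumes "smooth_near A p f" "(U, \<phi>) \<in> A" "p \<in> U"
  shows "(f \<circ> inv_into U \<phi> has_derivative frechet_derivative (f \<circ> inv_into U \<phi>) (at (\<phi> p))) (at (\<phi> p))"
  using smooth_nearE[OF assms] smooth_on_imp_has_derivative by metis

text \<open>Components of tangent vectors transform with the derivative of the change of coordinates,
  by the chain rule. So one chart suffices to describe the tangent space.\<close>
lemma chart_vector_change:
  assumes "(U, \<phi>) \<in> A" "(V, \<psi>) \<in> A" "p \<in> U" "p \<in> V"
  shows "\<exists>u'. chart_vector U \<phi> p u = chart_vector V \<psi> p u'"
proof -
  define T where "T = \<psi> \<circ> inv_into U \<phi>"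
  have T: "(T has_derivative frechet_derivative T (at (\<phi> p))) (at (\<phi> p))"
    unfolding T_def
    by (rule smooth_on_imp_has_derivative[OF chart_change_smooth[OF assms(1,2)]]) (use assms in auto)
  have Tp: "T (\<phi> p) = \<psi> p" by (simp add: T_def chart_inv[OF assms(1,3)])
  have "frechet_derivative (f \<circ> inv_into U \<phi>) (at (\<phi> p)) u =
      frechet_derivative (f \<circ> inv_into V \<psi>) (at (\<psi> p)) (frechet_derivative T (at (\<phi> p)) u)"
    if "smooth_near A p f" for f
  proof -
    have "((f \<circ> inv_into V \<psi>) \<circ> T has_derivative
        frechet_derivative (f \<circ> inv_into V \<psi>) (at (\<psi> p)) \<circ> frechet_derivative T (at (\<phi> p))) (at (\<phi> p))"
      using diff_chain_at[OF T] chart_rep_has_derivative[OF that assms(2,4)] Tp by simp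
    then have "(f \<circ> inv_into U \<phi> has_derivative
        frechet_derivative (f \<circ> inv_into V \<psi>) (at (\<psi> p)) \<circ> frechet_derivative T (at (\<phi> p))) (at (\<phi> p))"
      by (rule has_derivative_transform_within_open[OF _ chart_overlap_open[OF assms(1,2)]])
        (use assms in \<open>auto simp: T_def chart_inv[OF assms(1)] chart_inv[OF assms(2)]\<close>)
    then show ?thesis using frechet_derivative_at by (metis comp_apply)
  qed
  then show ?thesis
    unfolding chart_vector_def by (intro exI[of _ "frechet_derivative T (at (\<phi> p)) u"]) auto
qed

lemma tangent_space_chart:
  assumes "(U, \<phi>) \<in> A" "p \<in> U"
  shows "tangent_space A p = range (chart_vector U \<phi> p)"
proof -
  have "tangent_space A p = {v. \<exists>(V, \<psi>)\<in>A. p \<in> V \<and> (\<exists>u. v = chart_vector V \<psi> p u)}"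
    by (simp add: tangent_space_def chart_vector_def)
  then show ?thesis using assms chart_vector_change by (fastforce simp: image_iff)
qed

lemma tangent_space_points: "v \<in> tangent_space A p \<Longrightarrow> p \<in> points A"
  by (auto simp: tangent_space_def points_def)

lemma tangent_spaceE:
  assumes "v \<in> tangent_space A p"
  obtains U \<phi> u where "(U, \<phi>) \<in> A" "p \<in> U" "v = chart_vector U \<phi> p u"
  using assms by (auto simp: tangent_space_def chart_vector_def)

lemma chart_vector_coordinate:
  assumes "(U, \<phi>) \<in> A" "p \<in> U"
  shows "chart_vector U \<phi> p u (\<lambda>x. \<phi> x \<bullet> b) = u \<bullet> b"
proof -
  have "((\<lambda>x. \<phi> x \<bullet> b) \<circ> inv_into U \<phi> has_derivative (\<lambda>y. y \<bullet> b)) (at (\<phi> p))"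
    by (rule has_derivative_transform_within_open[OF _ chart_open[OF assms(1)], where f = "\<lambda>y. y \<bullet> b"])
      (use assms in \<open>auto simp: chart_inv[OF assms(1)] intro!: derivative_eq_intros\<close>)
  then have "frechet_derivative ((\<lambda>x. \<phi> x \<bullet> b) \<circ> inv_into U \<phi>) (at (\<phi> p)) = (\<lambda>y. y \<bullet> b)"
    using frechet_derivative_at by metis
  then show ?thesis
    using smooth_near_coordinate[OF assms] by (simp add: chart_vector_def)
qed

lemma tangent_not_smooth: "v \<in> tangent_space A p \<Longrightarrow> \<not> smooth_near A p f \<Longrightarrow> v f = 0"
  by (auto simp: chart_vector_def elim!: tangent_spaceE)

lemma tangent_add:
  assumes "v \<in> tangent_space A p" "smooth_near A p f" "smooth_near A p g"
  shows "v (\<lambda>x. f x + g x) = v f + v g"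
proof -
  obtain U \<phi> u where c: "(U, \<phi>) \<in> A" "p \<in> U" and v: "v = chart_vector U \<phi> p u"
    by (rule tangent_spaceE[OF assms(1)])
  note d = has_derivative_add[OF chart_rep_has_derivative[OF assms(2) c] chart_rep_has_derivative[OF assms(3) c]]
  show ?thesis
    using frechet_derivative_at[OF d, symmetric] smooth_near_add[OF assms(2,3)] assms(2,3)
    by (simp add: v chart_vector_def o_def)
qed

lemma tangent_mult:
  assumes "v \<in> tangent_space A p" "smooth_near A p f" "smooth_near A p g"
  shows "v (\<lambda>x. f x * g x) = v f * g p + f p * v g"
proof -
  obtain U \<phi> u where c: "(U, \<phi>) \<in> A" "p \<in> U" and v: "v = chart_vector U \<phi> p u"
    by (rule tangent_spaceE[OF assms(1)])
  note d = has_derivative_mult[OF chart_rep_has_derivative[OF assms(2) c] chart_rep_has_derivative[OF assms(3) c]]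
  show ?thesis
    using frechet_derivative_at[OF d, symmetric] smooth_near_mult[OF assms(2,3)] assms(2,3)
    by (simp add: v chart_vector_def o_def chart_inv[OF c])
qed

lemma tangent_const: "v \<in> tangent_space A p \<Longrightarrow> v (\<lambda>x. c) = 0"
  by (erule tangent_spaceE) (simp add: chart_vector_def o_def)

lemma tangent_cmult:
  assumes "v \<in> tangent_space A p" "smooth_near A p f"
  shows "v (\<lambda>x. c * f x) = c * v f"
  using tangent_mult[OF assms(1) smooth_near_const assms(2)] tangent_const[OF assms(1)]
    smooth_near_points[OF assms(2)] by simp

lemma tangent_sum:
  assumes "v \<in> tangent_space A p" "\<And>i. i \<in> J \<Longrightarrow> smooth_near A p (f i)"
  shows "v (\<lambda>x. \<Sum>i\<in>J. f i x) = (\<Sum>i\<in>J. v (f i))"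
  using assms(2)
proof (induction J rule: infinite_finite_induct)
  case (insert i J)
  then have "v (\<lambda>x. f i x + (\<Sum>i\<in>J. f i x)) = v (f i) + v (\<lambda>x. \<Sum>i\<in>J. f i x)"
    by (intro tangent_add[OF assms(1)] smooth_near_sum tangent_space_points[OF assms(1)]) auto
  then show ?case using insert by simp
qed (simp_all add: tangent_const[OF assms(1)])

text \<open>The chart representatives of two functions that agree on a chart domain agree on an open
  set, so their derivatives agree there too.\<close>

lemma tangent_cong_chart:
  assumes "v \<in> tangent_space A p" "(U, \<phi>) \<in> A" "p \<in> U" "\<And>x. x \<in> U \<Longrightarrow> f x = g x"
  shows "v f = v g"
proof (cases "smooth_near A p f")
  case True
  have g: "smooth_near A p g"
    by (rule smooth_near_cong_chart[OF assms(2-4) True])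
  obtain u where v: "v = chart_vector U \<phi> p u"
    using assms(1) tangent_space_chart[OF assms(2,3)] by blast
  have "(g \<circ> inv_into U \<phi> has_derivative frechet_derivative (f \<circ> inv_into U \<phi>) (at (\<phi> p))) (at (\<phi> p))"
    by (rule has_derivative_transform_within_open[OF chart_rep_has_derivative[OF True assms(2,3)]
          chart_open[OF assms(2)]])
      (use assms(3,4) in \<open>auto simp: chart_inv[OF assms(2)]\<close>)
  then show ?thesis
    using True g frechet_derivative_at[of "g \<circ> inv_into U \<phi>"] by (simp add: v chart_vector_def)
next
  case False
  moreover have "\<not> smooth_near A p g"
    using False smooth_near_cong_chart[OF assms(2,3), of g f] assms(4) by auto
  ultimately show ?thesis using tangent_not_smooth[OF assms(1)] by simp
qed

lemma tangent_cong:
  assumes "v \<in> tangent_space A p" "\<And>x. x \<in> points A \<Longrightarrow> f x = g x"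
  shows "v f = v g"
proof -
  obtain U \<phi> u where c: "(U, \<phi>) \<in> A" "p \<in> U"
    by (rule tangent_spaceE[OF assms(1)])
  show ?thesis
    by (rule tangent_cong_chart[OF assms(1) c]) (use assms(2) pointsI[OF c(1)] in blast)
qed

lemma chart_vector_eqI: 
  assumes "(U, \<phi>) \<in> A" "p \<in> U" "v \<in> tangent_space A p"
  shows "v = chart_vector U \<phi> p (\<Sum>b\<in>Basis. v (\<lambda>x. \<phi> x \<bullet> b) *\<^sub>R b)"
proof -
  obtain u where v: "v = chart_vector U \<phi> p u"
    using assms(3) tangent_space_chart[OF assms(1,2)] by blast
  have "(\<Sum>b\<in>Basis. v (\<lambda>x. \<phi> x \<bullet> b) *\<^sub>R b) = u"
    unfolding v chart_vector_coordinate[OF assms(1,2)] by (rule euclidean_representation)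
  then show ?thesis using v by simp
qed

text \<open>The components of a tangent vector in a chart are its values on the coordinate functions.\<close>

lemma tangent_eqI:
  assumes "(U, \<phi>) \<in> A" "p \<in> U" "v \<in> tangent_space A p" "w \<in> tangent_space A p"
    and "\<And>b. b \<in> Basis \<Longrightarrow> v (\<lambda>x. \<phi> x \<bullet> b) = w (\<lambda>x. \<phi> x \<bullet> b)"
  shows "v = w"
proof -
  have "(\<Sum>b\<in>Basis. v (\<lambda>x. \<phi> x \<bullet> b) *\<^sub>R b) = (\<Sum>b\<in>Basis. w (\<lambda>x. \<phi> x \<bullet> b) *\<^sub>R b)"
    using assms(5) by simp
  then show ?thesis
    using chart_vector_eqI[OF assms(1-3)] chart_vector_eqI[OF assms(1,2,4)] by simp
qed

lemma tangent_exists: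
  assumes "(U, \<phi>) \<in> A" "p \<in> U"
  shows "\<exists>v\<in>tangent_space A p. \<forall>b\<in>Basis. v (\<lambda>x. \<phi> x \<bullet> b) = c b"
proof (intro bexI ballI)
  show "chart_vector U \<phi> p (\<Sum>b\<in>Basis. c b *\<^sub>R b) \<in> tangent_space A p"
    using tangent_space_chart[OF assms] by blast
qed (simp add: chart_vector_coordinate[OF assms])

lemma chart_vector_linear:
  assumes "(U, \<phi>) \<in> A" "p \<in> U"
  shows "chart_vector U \<phi> p (a *\<^sub>R u + b *\<^sub>R u') =
    (\<lambda>f. a * chart_vector U \<phi> p u f + b * chart_vector U \<phi> p u' f)"
proof
  fix f
  show "chart_vector U \<phi> p (a *\<^sub>R u + b *\<^sub>R u') f =
      a * chart_vector U \<phi> p u f + b * chart_vector U \<phi> p u' f"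
    using has_derivative_linear[OF chart_rep_has_derivative[OF _ assms], of f]
    by (simp add: chart_vector_def linear_add linear_scale)
qed

lemma tangent_linear:
  assumes "v \<in> tangent_space A p" "w \<in> tangent_space A p"
  shows "(\<lambda>f. a * v f + b * w f) \<in> tangent_space A p"
proof -
  obtain U \<phi> u where c: "(U, \<phi>) \<in> A" "p \<in> U" and v: "v = chart_vector U \<phi> p u"
    by (rule tangent_spaceE[OF assms(1)])
  obtain u' where w: "w = chart_vector U \<phi> p u'"
    using assms(2) tangent_space_chart[OF c] by blast
  show ?thesis
    unfolding v w chart_vector_linear[OF c, symmetric] using tangent_space_chart[OF c] by blast
qed

lemma tangent_zero:
  assumes "p \<in> points A"
  shows "(\<lambda>f. 0) \<in> tangent_space A p"
proof -
  obtain U \<phi> where c: "(U, \<phi>) \<in> A" "p \<in> U"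
    by (rule points_chartE[OF assms])
  obtain v where "v \<in> tangent_space A p"
    using tangent_exists[OF c] by blast
  then show ?thesis using tangent_linear[of v p v 0 0] by simp
qed

lemma tangent_add_closed:
  "v \<in> tangent_space A p \<Longrightarrow> w \<in> tangent_space A p \<Longrightarrow> (\<lambda>f. v f + w f) \<in> tangent_space A p"
  using tangent_linear[of v p w 1 1] by simp

lemma tangent_sum_closed:
  assumes "p \<in> points A" "\<And>i. i \<in> J \<Longrightarrow> v i \<in> tangent_space A p"
  shows "(\<lambda>f. \<Sum>i\<in>J. c i * v i f) \<in> tangent_space A p"
  using assms(2)
proof (induction J rule: infinite_finite_induct)
  case (insert i J)
  then show ?case
    using tangent_linear[of "v i" p "\<lambda>f. \<Sum>i\<in>J. c i * v i f" "c i" 1] by simp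
qed (simp_all add: tangent_zero[OF assms(1)])

section \<open>The tangent bundle\<close>

lemma smooth_near_nearby:
  assumes "(U, \<phi>) \<in> A" "x \<in> U" "open W" "\<phi> x \<in> W" "W \<subseteq> \<phi> ` U" "smooth_on W (f \<circ> inv_into U \<phi>)"
  shows "smooth_near A x f"
  using assms smooth_near_chart_iff by blast

definition bundle_domain where
  "bundle_domain U = {(q, v)\<in>tangent_bundle A. q \<in> U}"

definition bundle_chart where
  "bundle_chart \<phi> = (\<lambda>(q, v). (\<phi> q, \<Sum>b\<in>Basis. v (\<lambda>p. \<phi> p \<bullet> b) *\<^sub>R b))"

lemma tangent_atlas_eq: "tangent_atlas A = (\<lambda>(U, \<phi>). (bundle_domain U, bundle_chart \<phi>)) ` A"
  by (simp add: tangent_atlas_def bundle_domain_def bundle_chart_def)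

lemma bundle_domain_iff: "w \<in> bundle_domain U \<longleftrightarrow> w \<in> tangent_bundle A \<and> fst w \<in> U"
  by (auto simp: bundle_domain_def)

lemma tangent_atlasI: "(U, \<phi>) \<in> A \<Longrightarrow> (bundle_domain U, bundle_chart \<phi>) \<in> tangent_atlas A"
  by (auto simp: tangent_atlas_eq)

lemma tangent_bundle_iff: "w \<in> tangent_bundle A \<longleftrightarrow> snd w \<in> tangent_space A (fst w)"
  by (auto simp: tangent_bundle_def tangent_space_points split: prod.splits)

lemma points_tangent_atlas: "points (tangent_atlas A) = tangent_bundle A"
proof (intro equalityI subsetI)
  fix w assume w: "w \<in> tangent_bundle A"
  then obtain U \<phi> where c: "(U, \<phi>) \<in> A" "fst w \<in> U"
    using points_chartE tangent_space_points tangent_bundle_iff by metis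
  have "w \<in> bundle_domain U" using w c by (simp add: bundle_domain_iff)
  then show "w \<in> points (tangent_atlas A)"
    using tangent_atlasI[OF c(1)] by (auto simp: points_def)
qed (auto simp: points_def tangent_atlas_eq bundle_domain_iff)

lemma bundle_chart_vector:
  assumes "(U, \<phi>) \<in> A" "x \<in> U"
  shows "bundle_chart \<phi> (x, chart_vector U \<phi> x y) = (\<phi> x, y)"
  by (simp add: bundle_chart_def chart_vector_coordinate[OF assms] euclidean_representation)

lemma chart_vector_bundle: "(U, \<phi>) \<in> A \<Longrightarrow> x \<in> U \<Longrightarrow> (x, chart_vector U \<phi> x y) \<in> bundle_domain U"
  using tangent_space_chart by (auto simp: bundle_domain_iff tangent_bundle_iff)

lemma bundle_domainE:
  assumes "(U, \<phi>) \<in> A" "w \<in> bundle_domain U"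
  obtains x y where "x \<in> U" "w = (x, chart_vector U \<phi> x y)" "bundle_chart \<phi> w = (\<phi> x, y)"
proof -
  obtain x v where w: "w = (x, v)" by (cases w)
  have x: "x \<in> U" using assms(2) w by (simp add: bundle_domain_iff)
  then obtain y where "v = chart_vector U \<phi> x y"
    using assms w tangent_space_chart[OF assms(1) x]
    by (auto simp: bundle_domain_iff tangent_bundle_iff)
  then show thesis using that x w bundle_chart_vector[OF assms(1) x] by simp
qed

lemma bundle_chart_inj: "(U, \<phi>) \<in> A \<Longrightarrow> inj_on (bundle_chart \<phi>) (bundle_domain U)"
proof (rule inj_onI)
  fix w w' assume a: "(U, \<phi>) \<in> A" "w \<in> bundle_domain U" "w' \<in> bundle_domain U"
    "bundle_chart \<phi> w = bundle_chart \<phi> w'"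
  obtain x y where w: "x \<in> U" "w = (x, chart_vector U \<phi> x y)" "bundle_chart \<phi> w = (\<phi> x, y)"
    by (rule bundle_domainE[OF a(1,2)])
  obtain x' y' where w': "x' \<in> U" "w' = (x', chart_vector U \<phi> x' y')" "bundle_chart \<phi> w' = (\<phi> x', y')"
    by (rule bundle_domainE[OF a(1,3)])
  have "x = x'" using a(4) w w' inj_onD[OF chart_inj[OF a(1)]] by simp
  then show "w = w'" using w w' a(4) by simp
qed

lemma bundle_chart_inv:
  "(U, \<phi>) \<in> A \<Longrightarrow> x \<in> U \<Longrightarrow>
    inv_into (bundle_domain U) (bundle_chart \<phi>) (\<phi> x, y) = (x, chart_vector U \<phi> x y)"
  using inv_into_f_f[OF bundle_chart_inj chart_vector_bundle] bundle_chart_vector by metis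

lemma bundle_chart_overlap:
  assumes "(U, \<phi>) \<in> A"
  shows "bundle_chart \<phi> ` (bundle_domain U \<inter> bundle_domain V) = \<phi> ` (U \<inter> V) \<times> UNIV"
proof (intro equalityI subsetI)
  fix z assume "z \<in> bundle_chart \<phi> ` (bundle_domain U \<inter> bundle_domain V)"
  then obtain w where w: "w \<in> bundle_domain U" "w \<in> bundle_domain V" "z = bundle_chart \<phi> w" by blast
  then show "z \<in> \<phi> ` (U \<inter> V) \<times> UNIV"
    by (auto simp: bundle_domain_iff bundle_chart_def split: prod.splits)
next
  fix z :: "'e \<times> 'e" assume "z \<in> \<phi> ` (U \<inter> V) \<times> UNIV"
  then obtain x y where x: "x \<in> U" "x \<in> V" and z: "z = (\<phi> x, y)" by auto
  have "(x, chart_vector U \<phi> x y) \<in> bundle_domain U \<inter> bundle_domain V"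
    using chart_vector_bundle[OF assms x(1), of y] x by (simp add: bundle_domain_iff)
  then show "z \<in> bundle_chart \<phi> ` (bundle_domain U \<inter> bundle_domain V)"
    using bundle_chart_vector[OF assms x(1), of y] z by (metis image_eqI)
qed

text \<open>If \<open>T\<close> is a change of coordinates on the base, then the one on the bundle is
  \<open>(x, y) \<mapsto> (T x, DT(x) y)\<close>, and its second part is built from differentials of the components
  of \<open>T\<close>.\<close>
lemma smooth_atlas_tangent_atlas: "smooth_atlas (tangent_atlas A)"
proof
  fix C \<xi> assume "(C, \<xi>) \<in> tangent_atlas A"
  then obtain U \<phi> where c: "(U, \<phi>) \<in> A" "C = bundle_domain U" "\<xi> = bundle_chart \<phi>"
    by (auto simp: tangent_atlas_eq)
  show "inj_on \<xi> C" using bundle_chart_inj c by simp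
  fix C' \<xi>' assume "(C', \<xi>') \<in> tangent_atlas A"
  then obtain V \<psi> where d: "(V, \<psi>) \<in> A" "C' = bundle_domain V" "\<xi>' = bundle_chart \<psi>"
    by (auto simp: tangent_atlas_eq)
  define S where "S = \<phi> ` (U \<inter> V)"
  define T where "T = \<psi> \<circ> inv_into U \<phi>"
  have S: "open S" and T: "smooth_on S T"
    using chart_overlap_open chart_change_smooth c d by (auto simp: S_def T_def)
  have dom: "\<xi> ` (C \<inter> C') = S \<times> UNIV"
    using bundle_chart_overlap c d by (simp add: S_def)
  show op: "open (\<xi> ` (C \<inter> C'))" using S dom by (simp add: open_Times)
  define r where "r b = (\<lambda>p. \<psi> p \<bullet> b) \<circ> inv_into U \<phi>" for b
  have r: "smooth_on S (r b)" for b
    using smooth_on_linear_comp[OF bounded_linear_inner_left S T, of b]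
    by (simp add: r_def T_def o_def)
  have op': "open (S \<times> (UNIV :: 'e set))" using op dom by simp
  have "smooth_on (S \<times> UNIV) (\<lambda>z. (T (fst z), \<Sum>b\<in>Basis. frechet_derivative (r b) (at (fst z)) (snd z) *\<^sub>R b))"
    by (intro smooth_on_Pair smooth_on_sum smooth_on_scaleR smooth_on_const op'
        smooth_on_differential[OF S r] smooth_on_compose[OF op' S _ T] smooth_on_linear bounded_linear_fst) auto
  then show "smooth_on (\<xi> ` (C \<inter> C')) (\<xi>' \<circ> inv_into C \<xi>)"
    unfolding dom
  proof (rule smooth_on_cong[OF op'])
    fix z :: "'e \<times> 'e" assume "z \<in> S \<times> UNIV"
    then obtain x y where x: "x \<in> U" "x \<in> V" and z: "z = (\<phi> x, y)" by (auto simp: S_def)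
    have "chart_vector U \<phi> x y (\<lambda>p. \<psi> p \<bullet> b) = frechet_derivative (r b) (at (\<phi> x)) y" for b
      using smooth_near_coordinate[OF d(1) x(2)] by (simp add: chart_vector_def r_def)
    then show "(T (fst z), \<Sum>b\<in>Basis. frechet_derivative (r b) (at (fst z)) (snd z) *\<^sub>R b) = (\<xi>' \<circ> inv_into C \<xi>) z"
      using bundle_chart_inv[OF c(1) x(1), of y] chart_inv[OF c(1) x(1)]
      by (simp add: z c d T_def bundle_chart_def)
  qed
qed

interpretation TQ: smooth_atlas "tangent_atlas A"
  by (rule smooth_atlas_tangent_atlas)

lemma bundle_chart_image: "(U, \<phi>) \<in> A \<Longrightarrow> bundle_chart \<phi> ` bundle_domain U = \<phi> ` U \<times> UNIV"
  using bundle_chart_overlap[of U \<phi> U] by simp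

lemma smooth_near_base:
  assumes "w \<in> tangent_bundle A" "smooth_near A (fst w) f"
  shows "smooth_near (tangent_atlas A) w (\<lambda>u. f (fst u))"
proof -
  obtain U \<phi> where c: "(U, \<phi>) \<in> A" "fst w \<in> U"
    by (rule points_chartE[OF smooth_near_points[OF assms(2)]])
  obtain W where W: "open W" "\<phi> (fst w) \<in> W" "W \<subseteq> \<phi> ` U" "smooth_on W (f \<circ> inv_into U \<phi>)"
    by (rule smooth_nearE[OF assms(2) c])
  have op: "open (W \<times> (UNIV :: 'e set))" using W by (simp add: open_Times)
  have w: "w \<in> bundle_domain U" using assms c by (simp add: bundle_domain_iff)
  have mem: "bundle_chart \<phi> w \<in> W \<times> UNIV"
    using W(2) by (cases w) (simp add: bundle_chart_def)
  have sub: "W \<times> UNIV \<subseteq> bundle_chart \<phi> ` bundle_domain U"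
    using W(3) bundle_chart_image[OF c(1)] by blast
  show ?thesis
  proof (rule TQ.smooth_nearI[OF tangent_atlasI[OF c(1)] w op mem sub])
    show "smooth_on (W \<times> (UNIV :: 'e set)) (\<lambda>z. (f \<circ> inv_into U \<phi>) (fst z))"
      by (rule smooth_on_compose[OF op W(1) _ W(4)]) (auto intro: smooth_on_linear bounded_linear_fst op)
  qed (auto simp: bundle_chart_def chart_inv[OF c(1)] bundle_domain_iff)
qed

lemma smooth_near_differential:
  assumes "w \<in> tangent_bundle A" "smooth_near A (fst w) f"
  shows "smooth_near (tangent_atlas A) w (\<lambda>u. snd u f)"
proof -
  obtain U \<phi> where c: "(U, \<phi>) \<in> A" "fst w \<in> U"
    by (rule points_chartE[OF smooth_near_points[OF assms(2)]])
  obtain W where W: "open W" "\<phi> (fst w) \<in> W" "W \<subseteq> \<phi> ` U" "smooth_on W (f \<circ> inv_into U \<phi>)"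
    by (rule smooth_nearE[OF assms(2) c])
  have op: "open (W \<times> (UNIV :: 'e set))" using W by (simp add: open_Times)
  have w: "w \<in> bundle_domain U" using assms c by (simp add: bundle_domain_iff)
  have mem: "bundle_chart \<phi> w \<in> W \<times> UNIV"
    using W(2) by (cases w) (simp add: bundle_chart_def)
  have sub: "W \<times> UNIV \<subseteq> bundle_chart \<phi> ` bundle_domain U"
    using W(3) bundle_chart_image[OF c(1)] by blast
  show ?thesis
  proof (rule TQ.smooth_nearI[OF tangent_atlasI[OF c(1)] w op mem sub smooth_on_differential[OF W(1,4)]])
    fix u assume u: "u \<in> bundle_domain U" "bundle_chart \<phi> u \<in> W \<times> UNIV"
    obtain x y where x: "x \<in> U" "u = (x, chart_vector U \<phi> x y)" "bundle_chart \<phi> u = (\<phi> x, y)"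
      by (rule bundle_domainE[OF c(1) u(1)])
    have "smooth_near A x f"
      by (rule smooth_near_nearby[OF c(1) x(1) W(1) _ W(3,4)]) (use u x in auto)
    then show "snd u f = frechet_derivative (f \<circ> inv_into U \<phi>) (at (fst (bundle_chart \<phi> u))) (snd (bundle_chart \<phi> u))"
      using x by (simp add: chart_vector_def)
  qed
qed

text \<open>In coordinates the push-forward of \<open>(a, c)\<close> along the projection is \<open>a\<close>, since a pulled back
  function does not depend on the fibre coordinates.\<close>

lemma tangent_push_forward:
  assumes "Z \<in> tangent_space (tangent_atlas A) w"
  shows "\<exists>v\<in>tangent_space A (fst w). \<forall>f. smooth_near A (fst w) f \<longrightarrow> Z (\<lambda>u. f (fst u)) = v f"
proof -
  have w: "w \<in> tangent_bundle A"
    using TQ.tangent_space_points[OF assms] by (simp add: points_tangent_atlas)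
  obtain U \<phi> where c: "(U, \<phi>) \<in> A" "fst w \<in> U"
    by (rule points_chartE[OF tangent_space_points]) (use w tangent_bundle_iff in blast)
  have wU: "w \<in> bundle_domain U" using w c by (simp add: bundle_domain_iff)
  note C = tangent_atlasI[OF c(1)] wU
  obtain a where Z: "Z = TQ.chart_vector (bundle_domain U) (bundle_chart \<phi>) w a"
    using assms TQ.tangent_space_chart[OF C] by blast
  have "Z (\<lambda>u. f (fst u)) = chart_vector U \<phi> (fst w) (fst a) f" if f: "smooth_near A (fst w) f" for f
  proof -
    define F where "F = (\<lambda>u. f (fst u)) \<circ> inv_into (bundle_domain U) (bundle_chart \<phi>)"
    have fst_w: "fst (bundle_chart \<phi> w) = \<phi> (fst w)" by (simp add: bundle_chart_def split: prod.splits)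
    have "((f \<circ> inv_into U \<phi>) \<circ> fst has_derivative
        frechet_derivative (f \<circ> inv_into U \<phi>) (at (\<phi> (fst w))) \<circ> fst) (at (bundle_chart \<phi> w))"
      by (rule diff_chain_at)
        (use chart_rep_has_derivative[OF f c] in \<open>auto simp: fst_w intro!: derivative_eq_intros\<close>)
    then have "(F has_derivative
        frechet_derivative (f \<circ> inv_into U \<phi>) (at (\<phi> (fst w))) \<circ> fst) (at (bundle_chart \<phi> w))"
    proof (rule has_derivative_transform_within_open[OF _ TQ.chart_open[OF C(1)]])
      show "bundle_chart \<phi> w \<in> bundle_chart \<phi> ` bundle_domain U" using wU by blast
    qed (auto simp: F_def bundle_chart_image[OF c(1)] bundle_chart_inv[OF c(1)] chart_inv[OF c(1)])
    then have "frechet_derivative F (at (bundle_chart \<phi> w)) =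
        frechet_derivative (f \<circ> inv_into U \<phi>) (at (\<phi> (fst w))) \<circ> fst"
      using frechet_derivative_at by metis
    then show ?thesis
      using smooth_near_base[OF w f] f by (simp add: Z TQ.chart_vector_def chart_vector_def F_def)
  qed
  moreover have "chart_vector U \<phi> (fst w) (fst a) \<in> tangent_space A (fst w)"
    using tangent_space_chart[OF c] by blast
  ultimately show ?thesis by blast
qed

text \<open>The induced coordinates of the bundle are the coordinate functions of the base and their
  differentials, so a tangent vector of the bundle is determined by, and can be prescribed on,
  these two families of functions.\<close>

lemma bundle_chart_components:
  "bundle_chart \<phi> u \<bullet> (b, 0) = \<phi> (fst u) \<bullet> b"
  "b \<in> Basis \<Longrightarrow> bundle_chart \<phi> u \<bullet> (0, b) = snd u (\<lambda>p. \<phi> p \<bullet> b)"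
  by (auto simp: bundle_chart_def inner_sum_left inner_Basis if_distrib cong: if_cong split: prod.splits)

lemma bundle_tangent_eqI:
  assumes "Z \<in> tangent_space (tangent_atlas A) w" "Z' \<in> tangent_space (tangent_atlas A) w"
    and "\<And>f. smooth_near A (fst w) f \<Longrightarrow> Z (\<lambda>u. f (fst u)) = Z' (\<lambda>u. f (fst u))"
    and "\<And>f. smooth_near A (fst w) f \<Longrightarrow> Z (\<lambda>u. snd u f) = Z' (\<lambda>u. snd u f)"
  shows "Z = Z'"
proof -
  have w: "w \<in> tangent_bundle A"
    using TQ.tangent_space_points[OF assms(1)] by (simp add: points_tangent_atlas)
  obtain U \<phi> where c: "(U, \<phi>) \<in> A" "fst w \<in> U"
    by (rule points_chartE[OF tangent_space_points]) (use w tangent_bundle_iff in blast)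
  have wU: "w \<in> bundle_domain U" using w c by (simp add: bundle_domain_iff)
  show ?thesis
  proof (rule TQ.tangent_eqI[OF tangent_atlasI[OF c(1)] wU assms(1,2)])
    fix b :: "'e \<times> 'e" assume "b \<in> Basis"
    then consider b' where "b' \<in> Basis" "b = (b', 0)" | b' where "b' \<in> Basis" "b = (0, b')"
      by (auto simp: Basis_prod_def)
    then show "Z (\<lambda>u. bundle_chart \<phi> u \<bullet> b) = Z' (\<lambda>u. bundle_chart \<phi> u \<bullet> b)"
      using assms(3,4)[OF smooth_near_coordinate[OF c]]
      by cases (simp_all add: bundle_chart_components)
  qed
qed

lemma bundle_tangent_exists:
  assumes "w \<in> tangent_bundle A" "(U, \<phi>) \<in> A" "fst w \<in> U"
  shows "\<exists>Z\<in>tangent_space (tangent_atlas A) w. \<forall>b\<in>Basis.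
    Z (\<lambda>u. \<phi> (fst u) \<bullet> b) = a b \<and> Z (\<lambda>u. snd u (\<lambda>p. \<phi> p \<bullet> b)) = c b"
proof -
  have wU: "w \<in> bundle_domain U" using assms by (simp add: bundle_domain_iff)
  \<comment> \<open>The basis of the product consists of the vectors \<open>(b, 0)\<close> and \<open>(0, b)\<close>.\<close>
  obtain Z where Z: "Z \<in> tangent_space (tangent_atlas A) w"
      "\<And>b. b \<in> Basis \<Longrightarrow> Z (\<lambda>u. bundle_chart \<phi> u \<bullet> b) = (if snd b = 0 then a (fst b) else c (snd b))"
    using TQ.tangent_exists[OF tangent_atlasI[OF assms(2)] wU,
        of "\<lambda>b. if snd b = 0 then a (fst b) else c (snd b)"] by blast
  have "Z (\<lambda>u. \<phi> (fst u) \<bullet> b) = a b" "Z (\<lambda>u. snd u (\<lambda>p. \<phi> p \<bullet> b)) = c b" if "b \<in> Basis" for b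
    using Z(2)[of "(b, 0)"] Z(2)[of "(0, b)"] that
    by (auto simp: bundle_chart_components Basis_prod_def nonzero_Basis)
  then show ?thesis using Z(1) by blast
qed

subsection \<open>Vertical lifts\<close>

text \<open>Moving the point along the fibre is motion along a line in the \<open>y\<close>-coordinates, with
  velocity the components of the lifted vector.\<close>
lemma vlift_chart_vector:
  assumes "w \<in> tangent_bundle A" "(U, \<phi>) \<in> A" "fst w \<in> U"
  shows "vlift A (chart_vector U \<phi> (fst w) c) w =
    TQ.chart_vector (bundle_domain U) (bundle_chart \<phi>) w (0, c)"
proof
  fix F
  have wU: "w \<in> bundle_domain U" using assms by (simp add: bundle_domain_iff)
  obtain x y where x: "x \<in> U" "w = (x, chart_vector U \<phi> x y)" "bundle_chart \<phi> w = (\<phi> x, y)"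
    by (rule bundle_domainE[OF assms(2) wU])
  show "vlift A (chart_vector U \<phi> (fst w) c) w F =
      TQ.chart_vector (bundle_domain U) (bundle_chart \<phi>) w (0, c) F"
  proof (cases "smooth_near (tangent_atlas A) w F")
    case True
    define R where "R = F \<circ> inv_into (bundle_domain U) (bundle_chart \<phi>)"
    define R' where "R' = frechet_derivative R (at (\<phi> x, y))"
    have R: "(R has_derivative R') (at (\<phi> x, y))"
      using TQ.chart_rep_has_derivative[OF True tangent_atlasI[OF assms(2)] wU] x(3)
      by (simp add: R_def R'_def)
    have "((\<lambda>t::real. (\<phi> x, y + t *\<^sub>R c)) has_derivative (\<lambda>t. (0, t *\<^sub>R c))) (at 0)"
      by (auto intro!: derivative_eq_intros)
    then have "(R \<circ> (\<lambda>t. (\<phi> x, y + t *\<^sub>R c)) has_derivative R' \<circ> (\<lambda>t. (0, t *\<^sub>R c))) (at 0)"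
      by (rule diff_chain_at) (use R in simp)
    moreover have "R' (0, t *\<^sub>R c) = R' (0, c) * t" for t
      using linear_scale[OF has_derivative_linear[OF R], of t "(0, c)"] by simp
    moreover have "R (\<phi> x, y + t *\<^sub>R c) =
        F (fst w, \<lambda>f. snd w f + t * chart_vector U \<phi> (fst w) c f)" for t
      using chart_vector_linear[OF assms(2) x(1), of 1 y t c]
      by (simp add: R_def bundle_chart_inv[OF assms(2) x(1)] x(2))
    ultimately have "((\<lambda>t. F (fst w, \<lambda>f. snd w f + t * chart_vector U \<phi> (fst w) c f))
        has_field_derivative R' (0, c)) (at 0)"
      by (simp add: has_field_derivative_def o_def)
    then show ?thesis
      using True x(3) DERIV_imp_deriv by (simp add: vlift_def TQ.chart_vector_def R'_def R_def)
  qed (simp add: vlift_def TQ.chart_vector_def)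
qed

lemma tangent_bundle_chartE:
  assumes "w \<in> tangent_bundle A"
  obtains U \<phi> where "(U, \<phi>) \<in> A" "fst w \<in> U"
  using assms points_chartE tangent_space_points tangent_bundle_iff by metis

lemma vlift_tangent:
  assumes "w \<in> tangent_bundle A" "u \<in> tangent_space A (fst w)"
  shows "vlift A u w \<in> tangent_space (tangent_atlas A) w"
proof -
  obtain U \<phi> where c: "(U, \<phi>) \<in> A" "fst w \<in> U" by (rule tangent_bundle_chartE[OF assms(1)])
  have wU: "w \<in> bundle_domain U" using assms c by (simp add: bundle_domain_iff)
  show ?thesis
    using assms(2) TQ.tangent_space_chart[OF tangent_atlasI[OF c(1)] wU] tangent_space_chart[OF c]
      vlift_chart_vector[OF assms(1) c] by auto
qed

lemma vlift_base: "vlift A u w (\<lambda>x. f (fst x)) = 0"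
  by (simp add: vlift_def)

lemma vlift_differential:
  assumes "w \<in> tangent_bundle A" "smooth_near A (fst w) f"
  shows "vlift A u w (\<lambda>x. snd x f) = u f"
proof -
  have "((\<lambda>t. snd w f + t * u f) has_field_derivative u f) (at 0)"
    by (auto intro!: derivative_eq_intros)
  then show ?thesis
    using smooth_near_differential[OF assms] DERIV_imp_deriv by (simp add: vlift_def)
qed

text \<open>The definition of the vertical lift as a derivative along a line does not show linearity in
  the direction of the line. But both sides are tangent vectors of the bundle, and they agree on
  pulled back functions and on differentials.\<close>
lemma vlift_linear:
  assumes w: "w \<in> tangent_bundle A" and u: "u \<in> tangent_space A (fst w)" "u' \<in> tangent_space A (fst w)"
  shows "vlift A (\<lambda>f. a * u f + b * u' f) w = (\<lambda>F. a * vlift A u w F + b * vlift A u' w F)"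
proof (rule bundle_tangent_eqI)
  show "vlift A (\<lambda>f. a * u f + b * u' f) w \<in> tangent_space (tangent_atlas A) w"
    by (intro vlift_tangent w tangent_linear u)
  show "(\<lambda>F. a * vlift A u w F + b * vlift A u' w F) \<in> tangent_space (tangent_atlas A) w"
    by (intro TQ.tangent_linear vlift_tangent w u)
qed (simp_all add: vlift_base vlift_differential[OF w])

lemma vlift_sum:
  assumes w: "w \<in> tangent_bundle A" and u: "\<And>i. i \<in> J \<Longrightarrow> u i \<in> tangent_space A (fst w)"
  shows "vlift A (\<lambda>f. \<Sum>i\<in>J. c i * u i f) w = (\<lambda>F. \<Sum>i\<in>J. c i * vlift A (u i) w F)"
  using u
proof (induction J rule: infinite_finite_induct)
  case (insert i J)
  have "(\<lambda>f. \<Sum>i\<in>J. c i * u i f) \<in> tangent_space A (fst w)"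
    using insert.prems w by (intro tangent_sum_closed) (auto simp: tangent_bundle_iff intro: tangent_space_points)
  then show ?case
    using insert vlift_linear[OF w, of "u i" "\<lambda>f. \<Sum>i\<in>J. c i * u i f" "c i" 1] by simp
qed (simp_all add: vlift_def fun_eq_iff)

text \<open>In bundle coordinates the lift of a field with components \<open>\<xi>\<^sup>b\<close> acts on \<open>F\<close> as
  \<open>\<xi>\<^sup>b \<partial>F/\<partial>y\<^sup>b\<close>.\<close>
lemma smooth_near_vlift:
  assumes "w \<in> tangent_bundle A" "field_along A \<xi>" "smooth_near (tangent_atlas A) w F"
  shows "smooth_near (tangent_atlas A) w (\<lambda>x. vlift A (\<xi> x) x F)"
proof -
  obtain U \<phi> where c: "(U, \<phi>) \<in> A" "fst w \<in> U" by (rule tangent_bundle_chartE[OF assms(1)])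
  have wU: "w \<in> bundle_domain U" using assms c by (simp add: bundle_domain_iff)
  note C = tangent_atlasI[OF c(1)]
  define R where "R = F \<circ> inv_into (bundle_domain U) (bundle_chart \<phi>)"
  obtain W where W: "open W" "bundle_chart \<phi> w \<in> W" "W \<subseteq> bundle_chart \<phi> ` bundle_domain U" "smooth_on W R"
    unfolding R_def by (rule TQ.smooth_nearE[OF assms(3) C wU])
  have comp: "smooth_near (tangent_atlas A) w (\<lambda>x. \<xi> x (\<lambda>p. \<phi> p \<bullet> b))" for b
    using assms(1,2) smooth_near_coordinate[OF c] by (simp add: field_along_def)
  have deriv: "smooth_near (tangent_atlas A) w (\<lambda>x. frechet_derivative R (at (bundle_chart \<phi> x)) (0, b))" for b
    by (rule TQ.smooth_nearI[OF C wU W(1-3) smooth_on_frechet_derivative[OF W(4)]]) simp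
  have "smooth_near (tangent_atlas A) w
      (\<lambda>x. \<Sum>b\<in>Basis. \<xi> x (\<lambda>p. \<phi> p \<bullet> b) * frechet_derivative R (at (bundle_chart \<phi> x)) (0, b))"
    by (intro TQ.smooth_near_sum TQ.smooth_near_mult comp deriv) (use assms(1) points_tangent_atlas in simp)
  then show ?thesis
  proof (rule TQ.smooth_near_cong_open[OF C wU W(1,2), rotated])
    fix x assume x: "x \<in> bundle_domain U" "bundle_chart \<phi> x \<in> W"
    have x': "x \<in> tangent_bundle A" "fst x \<in> U" using x by (auto simp: bundle_domain_iff)
    have \<xi>: "\<xi> x \<in> tangent_space A (fst x)" using assms(2) x' by (simp add: field_along_def)
    have F: "smooth_near (tangent_atlas A) x F"
      using TQ.smooth_near_nearby[OF C x(1) W(1) x(2) W(3)] W(4) R_def by simp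
    have lin: "linear (frechet_derivative R (at (bundle_chart \<phi> x)))"
      using smooth_on_imp_has_derivative[OF W(4) x(2)] has_derivative_linear by blast
    define y where "y = (\<Sum>b\<in>Basis. \<xi> x (\<lambda>p. \<phi> p \<bullet> b) *\<^sub>R b)"
    have y: "(0, y) = (\<Sum>b\<in>Basis. \<xi> x (\<lambda>p. \<phi> p \<bullet> b) *\<^sub>R ((0::'e), b))"
      by (simp add: y_def prod_eq_iff fst_sum snd_sum)
    have "vlift A (\<xi> x) x F = frechet_derivative R (at (bundle_chart \<phi> x)) (0, y)"
      using vlift_chart_vector[OF x'(1) c(1) x'(2), of y] chart_vector_eqI[OF c(1) x'(2) \<xi>] F
      by (simp add: y_def TQ.chart_vector_def R_def)
    then show "(\<Sum>b\<in>Basis. \<xi> x (\<lambda>p. \<phi> p \<bullet> b) * frechet_derivative R (at (bundle_chart \<phi> x)) (0, b)) =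
        vlift A (\<xi> x) x F"
      by (simp only: y linear_sum[OF lin] linear_scale[OF lin] real_scaleR_def)
  qed
qed

end

section \<open>Adapted frames on a Riemannian manifold\<close>

lemma smooth_manifold_imp_smooth_atlas:
  assumes "smooth_manifold A"
  shows "smooth_atlas A"
proof
  fix U \<phi> assume c: "(U, \<phi>) \<in> A"
  then have U: "open U" "open (\<phi> ` U)" "homeomorphism U (\<phi> ` U) \<phi> (inv_into U \<phi>)"
    using assms by (auto simp: smooth_manifold_def)
  show "inj_on \<phi> U"
    by (rule inj_on_inverseI) (rule homeomorphism_apply1[OF U(3)])
  fix V \<psi> assume d: "(V, \<psi>) \<in> A"
  then have "open V" using assms by (auto simp: smooth_manifold_def)
  then have "openin (top_of_set U) (U \<inter> V)" by (simp add: openin_open_Int)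
  then show "open (\<phi> ` (U \<inter> V))"
    using homeomorphism_imp_open_map[OF U(3)] U(2) openin_open_trans by blast
  show "smooth_on (\<phi> ` (U \<inter> V)) (\<psi> \<circ> inv_into U \<phi>)"
    using assms c d by (auto simp: smooth_manifold_def)
qed

locale adapted_geometry =
  fixes A :: "('q::{t2_space, second_countable_topology}, real ^ 'n::finite) chart set"
    and g :: "'q metric"
    and D :: "'q \<Rightarrow> 'q tvec set"
    and I :: "'n set"
    and X :: "'n \<Rightarrow> 'q vfield"
    and nabg :: "'q connection"
  assumes manifold: "smooth_manifold A"
    and metric: "riemannian_metric A g"
    and adapted: "adapted_frame A g D I X"
    and levi_civita: "levi_civita A g nabg"

sublocale adapted_geometry \<subseteq> smooth_atlas A
  by (rule smooth_manifold_imp_smooth_atlas[OF manifold])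

context adapted_geometry
begin

interpretation TQ: smooth_atlas "tangent_atlas A"
  by (rule smooth_atlas_tangent_atlas)

abbreviation "T q \<equiv> tangent_space A q"
abbreviation "TT w \<equiv> tangent_space (tangent_atlas A) w"
abbreviation "L \<equiv> kinetic_lagrangian g"
abbreviation "qv \<equiv> quasi_velocity X"

lemma points_UNIV: "points A = UNIV"
  using manifold by (simp add: smooth_manifold_def)

lemma frame_field: "vector_field A (X \<alpha>)"
  using adapted by (simp add: adapted_frame_def frame_def)

lemma frame_tangent: "X \<alpha> q \<in> T q"
  using frame_field points_UNIV by (simp add: vector_field_def)

lemma frame_smooth: "smooth_near A q f \<Longrightarrow> smooth_near A q (\<lambda>p. X \<alpha> p f)"
  using frame_field points_UNIV by (simp add: vector_field_def)

lemma frame_sum_tangent: "(\<lambda>f. \<Sum>\<alpha>\<in>J. c \<alpha> * X \<alpha> q f) \<in> T q"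
  by (intro tangent_sum_closed frame_tangent) (simp add: points_UNIV)

lemma frame_ex1: "u \<in> T q \<Longrightarrow> \<exists>!c. u = (\<lambda>f. \<Sum>\<alpha>\<in>UNIV. c \<alpha> * X \<alpha> q f)"
  using adapted points_UNIV by (simp add: adapted_frame_def frame_def)

lemma frame_coeff_sum: "frame_coeff X q (\<lambda>f. \<Sum>\<alpha>\<in>UNIV. c \<alpha> * X \<alpha> q f) = c"
  unfolding frame_coeff_def
  by (rule the1_equality[OF frame_ex1[OF frame_sum_tangent]]) (rule refl)

lemma frame_expand: 
  assumes "u \<in> T q"
  shows "u f = (\<Sum>\<alpha>\<in>UNIV. frame_coeff X q u \<alpha> * X \<alpha> q f)"
  using theI'[OF frame_ex1[OF assms]] unfolding frame_coeff_def by (rule fun_cong)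

text \<open>Tangent vectors vanish on functions that are not smooth, so the smooth ones suffice to
  compare them.\<close>
lemma frame_coeff_eqI:
  assumes "u \<in> T q" "\<And>f. smooth_near A q f \<Longrightarrow> u f = (\<Sum>\<alpha>\<in>UNIV. c \<alpha> * X \<alpha> q f)"
  shows "frame_coeff X q u = c"
proof -
  have "u f = (\<Sum>\<alpha>\<in>UNIV. c \<alpha> * X \<alpha> q f)" for f
    using assms(2) tangent_not_smooth[OF assms(1)] tangent_not_smooth[OF frame_sum_tangent]
    by (cases "smooth_near A q f") auto
  then have "u = (\<lambda>f. \<Sum>\<alpha>\<in>UNIV. c \<alpha> * X \<alpha> q f)" ..
  then show ?thesis by (simp only: frame_coeff_sum)
qed

lemma frame_coeff_linear:
  assumes "u \<in> T q" "v \<in> T q"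
  shows "frame_coeff X q (\<lambda>f. a * u f + b * v f) = (\<lambda>\<alpha>. a * frame_coeff X q u \<alpha> + b * frame_coeff X q v \<alpha>)"
  by (rule frame_coeff_eqI[OF tangent_linear[OF assms]])
    (simp add: frame_expand[OF assms(1)] frame_expand[OF assms(2)] sum_distrib_left sum.distrib algebra_simps)

lemma snd_tangent: "w \<in> tangent_bundle A \<Longrightarrow> snd w \<in> T (fst w)"
  by (simp add: tangent_bundle_iff)

lemma velocity_expand: "w \<in> tangent_bundle A \<Longrightarrow> snd w f = (\<Sum>\<alpha>\<in>UNIV. qv \<alpha> w * X \<alpha> (fst w) f)"
  using frame_expand[OF snd_tangent] by (simp add: quasi_velocity_def)

lemma velocity_eq: "w \<in> tangent_bundle A \<Longrightarrow> snd w = (\<lambda>f. \<Sum>\<alpha>\<in>UNIV. qv \<alpha> w * X \<alpha> (fst w) f)"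
  by (rule ext) (rule velocity_expand)

text \<open>In a chart the coefficients solve a linear system whose matrix consists of the components
  of the frame. It is invertible since the frame is pointwise independent, and Cramer's
  rule exhibits the solution as a quotient of determinants.\<close>

lemma smooth_near_frame_coeff:
  assumes w: "w \<in> tangent_bundle A" and \<xi>: "field_along A \<xi>"
  shows "smooth_near (tangent_atlas A) w (\<lambda>u. frame_coeff X (fst u) (\<xi> u) k)"
proof -
  obtain U \<phi> where c: "(U, \<phi>) \<in> A" "fst w \<in> U" by (rule tangent_bundle_chartE[OF w])
  have wU: "w \<in> bundle_domain U" using w c by (simp add: bundle_domain_iff)
  define x where "x i = (\<lambda>p. \<phi> p \<bullet> axis i (1::real))" for i
  define M where "M u = (\<chi> i j. X j (fst u) (x i))" for u :: "'q tpoint"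
  have det: "det (M u) \<noteq> 0" if u: "fst u \<in> U" for u
  proof -
    have "y = 0" if y: "M u *v y = 0" for y
    proof -
      have "(\<lambda>f. \<Sum>\<alpha>\<in>UNIV. y $ \<alpha> * X \<alpha> (fst u) f) = (\<lambda>f. 0)"
      proof (rule tangent_eqI[OF c(1) u frame_sum_tangent tangent_zero])
        fix b :: "real ^ 'n" assume "b \<in> Basis"
        then obtain i where b: "b = axis i 1" by (auto simp: Basis_vec_def)
        have "(M u *v y) $ i = 0" using y by simp
        then show "(\<Sum>\<alpha>\<in>UNIV. y $ \<alpha> * X \<alpha> (fst u) (\<lambda>x. \<phi> x \<bullet> b)) = 0"
          by (simp add: b M_def x_def matrix_vector_mult_def mult.commute)
      qed (simp add: points_UNIV)
      then have "(\<lambda>\<alpha>. y $ \<alpha>) = (\<lambda>\<alpha>. 0)"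
        using frame_coeff_sum[of "fst u" "\<lambda>\<alpha>. y $ \<alpha>"] frame_coeff_sum[of "fst u" "\<lambda>\<alpha>. 0"] by simp
      then show "y = 0" by (simp add: vec_eq_iff fun_eq_iff)
    qed
    then have "invertible (M u)"
      using invertible_left_inverse matrix_left_invertible_ker by metis
    then show ?thesis by (simp add: invertible_det_nz)
  qed
  define N where "N u = (\<chi> i j. if j = k then \<xi> u (x i) else M u $ i $ j)" for u
  have x: "smooth_near A (fst w) (x i)" for i
    unfolding x_def by (rule smooth_near_coordinate[OF c])
  have pw: "w \<in> points (tangent_atlas A)" using w points_tangent_atlas by simp
  have M: "smooth_near (tangent_atlas A) w (\<lambda>u. M u $ i $ j)" for i j
    using smooth_near_base[OF w frame_smooth[OF x]] by (simp add: M_def)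
  have "smooth_near (tangent_atlas A) w (\<lambda>u. N u $ i $ j)" for i j
    using M[of i j] \<xi> w x by (cases "j = k") (simp_all add: N_def field_along_def)
  then have "smooth_near (tangent_atlas A) w (\<lambda>u. det (N u) * inverse (det (M u)))"
    using M det[OF c(2)] by (intro TQ.smooth_near_mult TQ.smooth_near_inverse TQ.smooth_near_det pw)
  then show ?thesis
  proof (rule TQ.smooth_near_cong_chart[OF tangent_atlasI[OF c(1)] wU, rotated])
    fix u assume "u \<in> bundle_domain U"
    then have u: "u \<in> tangent_bundle A" "fst u \<in> U" by (auto simp: bundle_domain_iff)
    define y where "y = (\<chi> j. frame_coeff X (fst u) (\<xi> u) j)"
    have "\<xi> u \<in> T (fst u)" using \<xi> u by (simp add: field_along_def)
    then have "M u *v y = (\<chi> i. \<xi> u (x i))"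
      using frame_expand[of "\<xi> u" "fst u"]
      by (simp add: M_def y_def matrix_vector_mult_def mult.commute)
    then have "y = (\<chi> k. det (\<chi> i j. if j = k then (\<chi> i. \<xi> u (x i)) $ i else M u $ i $ j) / det (M u))"
      using cramer[OF det[OF u(2)], of y "\<chi> i. \<xi> u (x i)"] by blast
    then have "y $ k = det (N u) / det (M u)"
      by (simp only: N_def vec_lambda_beta)
    then show "det (N u) * inverse (det (M u)) = frame_coeff X (fst u) (\<xi> u) k"
      by (simp add: y_def divide_inverse)
  qed
qed

lemma field_along_velocity: "field_along A (\<lambda>w. snd w)"
  using smooth_near_differential by (simp add: field_along_def tangent_bundle_iff)

lemma smooth_near_quasi_velocity:
  "w \<in> tangent_bundle A \<Longrightarrow> smooth_near (tangent_atlas A) w (qv \<alpha>)"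
  using smooth_near_frame_coeff[OF _ field_along_velocity] by (simp add: quasi_velocity_def[abs_def])

subsection \<open>The metric in the frame\<close>

lemma metric_sym: "u \<in> T q \<Longrightarrow> v \<in> T q \<Longrightarrow> g q u v = g q v u"
  using metric points_UNIV by (simp add: riemannian_metric_def)

lemma metric_linear:
  "u \<in> T q \<Longrightarrow> v \<in> T q \<Longrightarrow> w \<in> T q \<Longrightarrow> g q (\<lambda>f. a * u f + b * v f) w = a * g q u w + b * g q v w"
  using metric points_UNIV by (simp add: riemannian_metric_def)

lemma metric_pos: "u \<in> T q \<Longrightarrow> u \<noteq> (\<lambda>f. 0) \<Longrightarrow> g q u u > 0"
  using metric points_UNIV by (simp add: riemannian_metric_def)

lemma metric_zero: "w \<in> T q \<Longrightarrow> g q (\<lambda>f. 0) w = 0"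
  using metric_linear[of w q w w 0 0] by simp

lemma metric_sum:
  assumes "w \<in> T q" "\<And>i. i \<in> J \<Longrightarrow> u i \<in> T q"
  shows "g q (\<lambda>f. \<Sum>i\<in>J. c i * u i f) w = (\<Sum>i\<in>J. c i * g q (u i) w)"
  using assms(2)
proof (induction J rule: infinite_finite_induct)
  case (insert i J)
  have "(\<lambda>f. \<Sum>i\<in>J. c i * u i f) \<in> T q"
    using insert.prems by (intro tangent_sum_closed) (auto simp: points_UNIV)
  then show ?case
    using insert metric_linear[of "u i" q "\<lambda>f. \<Sum>i\<in>J. c i * u i f" w "c i" 1] assms(1) by simp
qed (simp_all add: metric_zero[OF assms(1)])

lemma metric_diff:
  "u \<in> T q \<Longrightarrow> v \<in> T q \<Longrightarrow> w \<in> T q \<Longrightarrow> g q (\<lambda>f. u f - v f) w = g q u w - g q v w"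
  using metric_linear[of u q v w 1 "-1"] by simp

lemma metric_add:
  "u \<in> T q \<Longrightarrow> v \<in> T q \<Longrightarrow> w \<in> T q \<Longrightarrow> g q (\<lambda>f. u f + v f) w = g q u w + g q v w"
  using metric_linear[of u q v w 1 1] by simp

lemma metric_frame_eq_zero:
  assumes "u \<in> T q" "\<And>\<beta>. g q u (X \<beta> q) = 0"
  shows "u = (\<lambda>f. 0)"
proof -
  have "g q u u = g q (\<lambda>f. \<Sum>\<alpha>\<in>UNIV. frame_coeff X q u \<alpha> * X \<alpha> q f) u"
    by (simp only: frame_expand[OF assms(1), symmetric])
  also have "\<dots> = (\<Sum>\<alpha>\<in>UNIV. frame_coeff X q u \<alpha> * g q (X \<alpha> q) u)"
    by (rule metric_sum[OF assms(1) frame_tangent])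
  also have "\<dots> = 0"
    using assms(2) metric_sym[OF assms(1) frame_tangent] by simp
  finally show ?thesis using metric_pos[OF assms(1)] by force
qed

lemma metric_velocity:
  assumes "w \<in> tangent_bundle A" "u \<in> T (fst w)"
  shows "(\<Sum>\<beta>\<in>UNIV. qv \<beta> w * g (fst w) (X \<beta> (fst w)) u) = g (fst w) u (snd w)"
    and "(\<Sum>\<beta>\<in>UNIV. qv \<beta> w * g (fst w) u (X \<beta> (fst w))) = g (fst w) u (snd w)"
proof -
  show *: "(\<Sum>\<beta>\<in>UNIV. qv \<beta> w * g (fst w) (X \<beta> (fst w)) u) = g (fst w) u (snd w)"
    unfolding metric_sym[OF assms(2) snd_tangent[OF assms(1)]]
    by (subst velocity_eq[OF assms(1)]) (rule metric_sum[OF assms(2) frame_tangent, symmetric])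
  then show "(\<Sum>\<beta>\<in>UNIV. qv \<beta> w * g (fst w) u (X \<beta> (fst w))) = g (fst w) u (snd w)"
    using metric_sym[OF assms(2) frame_tangent] by simp
qed

definition metric_coeff where "metric_coeff \<alpha> \<beta> q = g q (X \<alpha> q) (X \<beta> q)"

lemma smooth_near_metric_coeff: "smooth_near A q (metric_coeff \<alpha> \<beta>)"
proof -
  have "smooth_fun A (\<lambda>q. g q (X \<alpha> q) (X \<beta> q))"
    using metric frame_field by (simp add: riemannian_metric_def)
  then show ?thesis by (simp add: smooth_fun_def points_UNIV metric_coeff_def[abs_def])
qed

text \<open>The momentum \<open>\<partial>L/\<partial>v\<^sup>\<beta>\<close> conjugate to the quasi-velocity \<open>v\<^sup>\<beta>\<close>.\<close>
definition momentum where
  "momentum \<beta> u = g (fst u) (snd u) (X \<beta> (fst u))"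

lemma momentum_expand:
  assumes "u \<in> tangent_bundle A"
  shows "momentum \<beta> u = (\<Sum>\<alpha>\<in>UNIV. qv \<alpha> u * metric_coeff \<alpha> \<beta> (fst u))"
  unfolding momentum_def metric_coeff_def
  by (subst velocity_eq[OF assms]) (rule metric_sum[OF frame_tangent frame_tangent])

lemma kinetic_expand:
  assumes "u \<in> tangent_bundle A"
  shows "L u = (\<Sum>\<beta>\<in>UNIV. 1/2 * (qv \<beta> u * momentum \<beta> u))"
proof -
  note v = snd_tangent[OF assms]
  have "g (fst u) (snd u) (snd u) = (\<Sum>\<beta>\<in>UNIV. qv \<beta> u * g (fst u) (X \<beta> (fst u)) (snd u))"
    using metric_sum[of "snd u" "fst u" UNIV "\<lambda>\<alpha>. X \<alpha> (fst u)" "\<lambda>\<alpha>. qv \<alpha> u", OF v frame_tangent]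
    by (simp only: velocity_eq[OF assms, symmetric])
  then show ?thesis
    using metric_sym[OF v frame_tangent]
    by (simp add: kinetic_lagrangian_def momentum_def sum_divide_distrib)
qed

lemma smooth_near_momentum:
  assumes "w \<in> tangent_bundle A"
  shows "smooth_near (tangent_atlas A) w (momentum \<beta>)"
  by (rule TQ.smooth_near_cong[where f = "\<lambda>u. \<Sum>\<alpha>\<in>UNIV. qv \<alpha> u * metric_coeff \<alpha> \<beta> (fst u)"])
    (use assms in \<open>auto simp: momentum_expand points_tangent_atlas intro!: TQ.smooth_near_sum
      TQ.smooth_near_mult smooth_near_quasi_velocity smooth_near_base smooth_near_metric_coeff\<close>)

lemma smooth_near_kinetic:
  assumes "w \<in> tangent_bundle A"
  shows "smooth_near (tangent_atlas A) w L"
  by (rule TQ.smooth_near_cong[where f = "\<lambda>u. \<Sum>\<beta>\<in>UNIV. 1/2 * (qv \<beta> u * momentum \<beta> u)"])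
    (use assms in \<open>auto simp: kinetic_expand points_tangent_atlas simp del: times_divide_eq_left mult_1
      intro!: TQ.smooth_near_sum TQ.smooth_near_const
      TQ.smooth_near_mult smooth_near_quasi_velocity smooth_near_momentum\<close>)

lemma vlift_kinetic:
  assumes w: "w \<in> tangent_bundle A"
  shows "vlift A (X \<beta> (fst w)) w L = momentum \<beta> w"
proof -
  let ?q = "fst w" and ?v = "snd w" and ?x = "X \<beta> (fst w)"
  note v = snd_tangent[OF w]
  have "L (?q, \<lambda>f. ?v f + t * ?x f) =
      1/2 * (g ?q ?v ?v + 2 * t * g ?q ?v ?x + t\<^sup>2 * g ?q ?x ?x)" for t
  proof -
    have u: "(\<lambda>f. 1 * ?v f + t * ?x f) \<in> T ?q" by (rule tangent_linear[OF v frame_tangent])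
    show ?thesis
      using metric_linear[OF v frame_tangent u, of 1 t \<beta>] metric_linear[OF v frame_tangent v, of 1 t \<beta>]
        metric_linear[OF v frame_tangent frame_tangent[of \<beta>], of 1 t \<beta>]
        metric_sym[OF u v] metric_sym[OF u frame_tangent] metric_sym[OF v frame_tangent]
      by (simp add: kinetic_lagrangian_def algebra_simps power2_eq_square)
  qed
  moreover have "((\<lambda>t. 1/2 * (g ?q ?v ?v + 2 * t * g ?q ?v ?x + t\<^sup>2 * g ?q ?x ?x))
      has_field_derivative g ?q ?v ?x) (at 0)"
    by (auto intro!: derivative_eq_intros)
  ultimately have "((\<lambda>t. L (?q, \<lambda>f. ?v f + t * ?x f)) has_field_derivative g ?q ?v ?x) (at 0)"
    by (simp only:)
  then show ?thesis
    using smooth_near_kinetic[OF w] DERIV_imp_deriv by (simp add: vlift_def momentum_def)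
qed

subsection \<open>Derivatives along tangent vectors of the bundle\<close>

text \<open>The frame identifies \<open>TQ\<close> with \<open>Q \<times> \<real>\<^sup>n\<close>. This is the fibre component of \<open>Z\<close> in the resulting
  splitting, regarded as a vector at the base point. Together with the push-forward \<open>a\<close> of \<open>Z\<close> it
  determines how \<open>Z\<close> acts on differentials, momenta and the kinetic energy, since these are
  polynomials in the quasi-velocities with coefficients pulled back from the base.\<close>
definition fibre_part where
  "fibre_part w Z = (\<lambda>f. \<Sum>\<alpha>\<in>UNIV. Z (qv \<alpha>) * X \<alpha> (fst w) f)"

lemma fibre_part_tangent: "fibre_part w Z \<in> T (fst w)"
  unfolding fibre_part_def by (rule frame_sum_tangent)

lemma tangent_differential:
  assumes w: "w \<in> tangent_bundle A" and Z: "Z \<in> TT w"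
    and a: "\<And>f. smooth_near A (fst w) f \<Longrightarrow> Z (\<lambda>u. f (fst u)) = a f"
    and f: "smooth_near A (fst w) f"
  shows "Z (\<lambda>u. snd u f) = fibre_part w Z f + (\<Sum>\<alpha>\<in>UNIV. qv \<alpha> w * a (\<lambda>p. X \<alpha> p f))"
proof -
  note sm = smooth_near_quasi_velocity[OF w] smooth_near_base[OF w frame_smooth[OF f]]
  have "Z (\<lambda>u. snd u f) = Z (\<lambda>u. \<Sum>\<alpha>\<in>UNIV. qv \<alpha> u * X \<alpha> (fst u) f)"
    by (rule TQ.tangent_cong[OF Z]) (simp add: points_tangent_atlas velocity_expand)
  also have "\<dots> = (\<Sum>\<alpha>\<in>UNIV. Z (\<lambda>u. qv \<alpha> u * X \<alpha> (fst u) f))"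
    by (rule TQ.tangent_sum[OF Z]) (intro TQ.smooth_near_mult sm)
  also have "\<dots> = (\<Sum>\<alpha>\<in>UNIV. Z (qv \<alpha>) * X \<alpha> (fst w) f + qv \<alpha> w * a (\<lambda>p. X \<alpha> p f))"
    using TQ.tangent_mult[OF Z sm] a[OF frame_smooth[OF f]] by simp
  finally show ?thesis by (simp add: fibre_part_def sum.distrib)
qed

lemma tangent_momentum:
  assumes w: "w \<in> tangent_bundle A" and Z: "Z \<in> TT w"
    and a: "\<And>f. smooth_near A (fst w) f \<Longrightarrow> Z (\<lambda>u. f (fst u)) = a f"
  shows "Z (momentum \<beta>) =
    g (fst w) (fibre_part w Z) (X \<beta> (fst w)) + (\<Sum>\<alpha>\<in>UNIV. qv \<alpha> w * a (metric_coeff \<alpha> \<beta>))"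
proof -
  note sm = smooth_near_quasi_velocity[OF w] smooth_near_base[OF w smooth_near_metric_coeff]
  have "Z (momentum \<beta>) = Z (\<lambda>u. \<Sum>\<alpha>\<in>UNIV. qv \<alpha> u * metric_coeff \<alpha> \<beta> (fst u))"
    by (rule TQ.tangent_cong[OF Z]) (simp add: points_tangent_atlas momentum_expand)
  also have "\<dots> = (\<Sum>\<alpha>\<in>UNIV. Z (\<lambda>u. qv \<alpha> u * metric_coeff \<alpha> \<beta> (fst u)))"
    by (rule TQ.tangent_sum[OF Z]) (intro TQ.smooth_near_mult sm)
  also have "\<dots> = (\<Sum>\<alpha>\<in>UNIV. Z (qv \<alpha>) * metric_coeff \<alpha> \<beta> (fst w) + qv \<alpha> w * a (metric_coeff \<alpha> \<beta>))"
    using TQ.tangent_mult[OF Z sm] a[OF smooth_near_metric_coeff] by simp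
  finally show ?thesis
    using metric_sum[of "X \<beta> (fst w)" "fst w" UNIV "\<lambda>\<alpha>. X \<alpha> (fst w)" "\<lambda>\<alpha>. Z (qv \<alpha>)", OF frame_tangent frame_tangent]
    by (simp add: fibre_part_def sum.distrib metric_coeff_def)
qed

lemma tangent_kinetic:
  assumes w: "w \<in> tangent_bundle A" and Z: "Z \<in> TT w"
    and a: "\<And>f. smooth_near A (fst w) f \<Longrightarrow> Z (\<lambda>u. f (fst u)) = a f"
  shows "Z L = g (fst w) (fibre_part w Z) (snd w) +
    1/2 * (\<Sum>\<beta>\<in>UNIV. \<Sum>\<alpha>\<in>UNIV. qv \<beta> w * qv \<alpha> w * a (metric_coeff \<alpha> \<beta>))"
proof -
  let ?\<zeta> = "fibre_part w Z"
  note v = snd_tangent[OF w]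
  note sm = smooth_near_quasi_velocity[OF w] smooth_near_momentum[OF w]
  have "Z L = Z (\<lambda>u. \<Sum>\<beta>\<in>UNIV. 1/2 * (qv \<beta> u * momentum \<beta> u))"
    by (rule TQ.tangent_cong[OF Z]) (simp add: points_tangent_atlas kinetic_expand)
  also have "\<dots> = (\<Sum>\<beta>\<in>UNIV. Z (\<lambda>u. 1/2 * (qv \<beta> u * momentum \<beta> u)))"
    by (rule TQ.tangent_sum[OF Z])
      (intro TQ.smooth_near_mult sm TQ.smooth_near_const, simp add: points_tangent_atlas w)
  also have "\<dots> = (\<Sum>\<beta>\<in>UNIV. 1/2 * (Z (qv \<beta>) * momentum \<beta> w + qv \<beta> w * Z (momentum \<beta>)))"
    using TQ.tangent_cmult[OF Z TQ.smooth_near_mult[OF sm]] TQ.tangent_mult[OF Z sm] by (simp only:)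
  also have "\<dots> = 1/2 * ((\<Sum>\<beta>\<in>UNIV. Z (qv \<beta>) * momentum \<beta> w) + (\<Sum>\<beta>\<in>UNIV. qv \<beta> w * Z (momentum \<beta>)))"
    by (simp only: sum_distrib_left[symmetric] sum.distrib)
  also have "(\<Sum>\<beta>\<in>UNIV. Z (qv \<beta>) * momentum \<beta> w) = g (fst w) ?\<zeta> (snd w)"
    using metric_sum[of "snd w" "fst w" UNIV "\<lambda>\<alpha>. X \<alpha> (fst w)" "\<lambda>\<alpha>. Z (qv \<alpha>)", OF v frame_tangent] metric_sym[OF v frame_tangent]
    by (simp add: fibre_part_def momentum_def)
  also have "(\<Sum>\<beta>\<in>UNIV. qv \<beta> w * Z (momentum \<beta>)) =
      g (fst w) ?\<zeta> (snd w) +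
      (\<Sum>\<beta>\<in>UNIV. \<Sum>\<alpha>\<in>UNIV. qv \<beta> w * qv \<alpha> w * a (metric_coeff \<alpha> \<beta>))"
    by (simp add: tangent_momentum[OF w Z a] metric_velocity(2)[OF w fibre_part_tangent]
        sum.distrib distrib_left sum_distrib_left mult.assoc)
  finally show ?thesis by (simp add: field_simps)
qed

section \<open>The geodesic spray\<close>

abbreviation "cov \<alpha> \<beta> q \<equiv> nabg (X \<alpha>) (X \<beta>) q"

lemma connection: "linear_connection A nabg"
  using levi_civita by (simp add: levi_civita_def)

lemma connection_tangent: "cov \<alpha> \<beta> q \<in> T q"
proof -
  have "vector_field A (nabg (X \<alpha>) (X \<beta>))"
    using connection frame_field by (simp add: linear_connection_def)
  then show ?thesis using points_UNIV by (simp add: vector_field_def)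
qed

lemma torsion_free: "lie_bracket A (X \<alpha>) (X \<beta>) q = (\<lambda>f. cov \<alpha> \<beta> q f - cov \<beta> \<alpha> q f)"
proof -
  have "(\<lambda>q f. cov \<alpha> \<beta> q f - cov \<beta> \<alpha> q f) = lie_bracket A (X \<alpha>) (X \<beta>)"
    using levi_civita frame_field by (simp add: levi_civita_def)
  then show ?thesis by (rule fun_cong[symmetric])
qed

lemma metric_compatible:
  "X \<delta> q (metric_coeff \<alpha> \<beta>) = g q (cov \<delta> \<alpha> q) (X \<beta> q) + g q (X \<alpha> q) (cov \<delta> \<beta> q)"
proof -
  have "\<forall>q. X \<delta> q (\<lambda>p. g p (X \<alpha> p) (X \<beta> p)) = g q (cov \<delta> \<alpha> q) (X \<beta> q) + g q (X \<alpha> q) (cov \<delta> \<beta> q)"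
    using levi_civita frame_field by (simp add: levi_civita_def)
  then show ?thesis by (simp add: metric_coeff_def[abs_def])
qed

lemma connection_diff_tangent: "(\<lambda>f. cov \<alpha> \<beta> q f - cov \<gamma> \<delta> q f) \<in> T q"
  using tangent_linear[where a = 1 and b = "-1", OF connection_tangent connection_tangent] by simp

lemma bracket_sum_tangent:
  "(\<lambda>f. \<Sum>\<gamma>\<in>UNIV. qv \<gamma> w * (cov \<gamma> \<beta> q f - cov \<beta> \<gamma> q f)) \<in> T q"
proof -
  show ?thesis
    by (rule tangent_sum_closed[OF _ connection_diff_tangent]) (simp add: points_UNIV)
qed

text \<open>Let \<open>Z\<close> take the required values on the coordinates \<open>x\<^sup>b\<close> and their differentials. Leibniz'
  rule for \<open>dx\<^sup>b = v\<^sup>\<gamma> X\<^sub>\<gamma>(x\<^sup>b)\<close> shows that its fibre part agrees on each \<open>x\<^sup>b\<close> with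
  \<open>v\<^sup>\<gamma> [X\<^sub>\<gamma>, X\<^sub>\<beta>]\<close>. As brackets of frame fields are differences of covariant derivatives, both are
  tangent vectors, so they are equal, and the same rule read backwards for an arbitrary \<open>f\<close> gives
  the required value on \<open>df\<close>.\<close>
lemma clift_frame_exists:
  assumes w: "w \<in> tangent_bundle A"
  shows "\<exists>Z\<in>TT w. fibre_part w Z = (\<lambda>f. \<Sum>\<gamma>\<in>UNIV. qv \<gamma> w * (cov \<gamma> \<beta> (fst w) f - cov \<beta> \<gamma> (fst w) f)) \<and>
    (\<forall>f. smooth_near A (fst w) f \<longrightarrow> Z (\<lambda>u. f (fst u)) = X \<beta> (fst w) f \<and>
      Z (\<lambda>u. snd u f) = snd w (\<lambda>p. X \<beta> p f))"
proof -
  let ?q = "fst w"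
  define br where "br = (\<lambda>f. \<Sum>\<gamma>\<in>UNIV. qv \<gamma> w * (cov \<gamma> \<beta> ?q f - cov \<beta> \<gamma> ?q f))"
  have br: "br f = (\<Sum>\<gamma>\<in>UNIV. qv \<gamma> w * X \<gamma> ?q (\<lambda>p. X \<beta> p f)) - (\<Sum>\<gamma>\<in>UNIV. qv \<gamma> w * X \<beta> ?q (\<lambda>p. X \<gamma> p f))"
    if "smooth_near A ?q f" for f
  proof -
    have "qv \<gamma> w * (cov \<gamma> \<beta> ?q f - cov \<beta> \<gamma> ?q f) =
        qv \<gamma> w * X \<gamma> ?q (\<lambda>p. X \<beta> p f) - qv \<gamma> w * X \<beta> ?q (\<lambda>p. X \<gamma> p f)" for \<gamma>
      using fun_cong[OF torsion_free[of \<gamma> \<beta> ?q], of f] that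
      by (simp add: lie_bracket_def right_diff_distrib[symmetric])
    then show ?thesis by (simp only: br_def sum_subtractf)
  qed
  obtain U \<phi> where c: "(U, \<phi>) \<in> A" "?q \<in> U" by (rule tangent_bundle_chartE[OF w])
  obtain Z where Z: "Z \<in> TT w"
    and Z_coord: "\<And>b. b \<in> Basis \<Longrightarrow> Z (\<lambda>u. \<phi> (fst u) \<bullet> b) = X \<beta> ?q (\<lambda>p. \<phi> p \<bullet> b)"
      "\<And>b. b \<in> Basis \<Longrightarrow> Z (\<lambda>u. snd u (\<lambda>p. \<phi> p \<bullet> b)) = snd w (\<lambda>p. X \<beta> p (\<lambda>x. \<phi> x \<bullet> b))"
    using bundle_tangent_exists[OF w c, of "\<lambda>b. X \<beta> ?q (\<lambda>p. \<phi> p \<bullet> b)"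
        "\<lambda>b. snd w (\<lambda>p. X \<beta> p (\<lambda>x. \<phi> x \<bullet> b))"] by blast
  obtain v where v: "v \<in> T ?q" "\<And>f. smooth_near A ?q f \<Longrightarrow> Z (\<lambda>u. f (fst u)) = v f"
    using tangent_push_forward[OF Z] by blast
  have "v = X \<beta> ?q"
    by (rule tangent_eqI[OF c v(1) frame_tangent])
      (use v(2)[OF smooth_near_coordinate[OF c]] Z_coord(1) in simp)
  then have base: "Z (\<lambda>u. f (fst u)) = X \<beta> ?q f" if "smooth_near A ?q f" for f
    using v(2)[OF that] by simp
  note diff = tangent_differential[OF w Z base]
  have fibre: "fibre_part w Z = br"
  proof (rule tangent_eqI[OF c fibre_part_tangent])
    show "br \<in> T ?q" unfolding br_def by (rule bracket_sum_tangent)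
    fix b :: "real ^ 'n" assume b: "b \<in> Basis"
    have sm: "smooth_near A ?q (\<lambda>x. \<phi> x \<bullet> b)" by (rule smooth_near_coordinate[OF c])
    show "fibre_part w Z (\<lambda>x. \<phi> x \<bullet> b) = br (\<lambda>x. \<phi> x \<bullet> b)"
      using diff[OF _ sm] Z_coord(2)[OF b] br[OF sm] velocity_expand[OF w] by simp
  qed
  have "Z (\<lambda>u. snd u f) = snd w (\<lambda>p. X \<beta> p f)" if f: "smooth_near A ?q f" for f
    using diff[OF _ f] br[OF f] velocity_expand[OF w] by (simp add: fibre)
  then show ?thesis using Z fibre base unfolding br_def by blast
qed

text \<open>The properties that define the complete lift determine it, because they include its values
  on pulled back functions and on differentials.\<close>
lemma clift_frame:
  assumes w: "w \<in> tangent_bundle A"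
  shows clift_tangent: "clift A (X \<beta>) w \<in> TT w"
    and clift_base: "smooth_near A (fst w) f \<Longrightarrow> clift A (X \<beta>) w (\<lambda>u. f (fst u)) = X \<beta> (fst w) f"
    and clift_differential:
      "smooth_near A (fst w) f \<Longrightarrow> clift A (X \<beta>) w (\<lambda>u. snd u f) = snd w (\<lambda>p. X \<beta> p f)"
    and clift_fibre_part: "fibre_part w (clift A (X \<beta>) w) =
      (\<lambda>f. \<Sum>\<gamma>\<in>UNIV. qv \<gamma> w * (cov \<gamma> \<beta> (fst w) f - cov \<beta> \<gamma> (fst w) f))"
proof -
  obtain Z where Z: "Z \<in> TT w"
    and fibre: "fibre_part w Z = (\<lambda>f. \<Sum>\<gamma>\<in>UNIV. qv \<gamma> w * (cov \<gamma> \<beta> (fst w) f - cov \<beta> \<gamma> (fst w) f))"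
    and lifts: "\<forall>f. smooth_near A (fst w) f \<longrightarrow> Z (\<lambda>u. f (fst u)) = X \<beta> (fst w) f \<and>
      Z (\<lambda>u. snd u f) = snd w (\<lambda>p. X \<beta> p f)"
    using clift_frame_exists[OF w, of \<beta>] by blast
  have "clift A (X \<beta>) w = Z"
    unfolding clift_def
  proof (rule the_equality)
    fix Z' assume "Z' \<in> TT w \<and> (\<forall>f. smooth_near A (fst w) f \<longrightarrow>
      Z' (\<lambda>u. f (fst u)) = X \<beta> (fst w) f \<and> Z' (\<lambda>u. snd u f) = snd w (\<lambda>p. X \<beta> p f))"
    then show "Z' = Z" using Z lifts by (intro bundle_tangent_eqI) auto
  qed (use Z lifts in blast)
  then show "clift A (X \<beta>) w \<in> TT w"
    "smooth_near A (fst w) f \<Longrightarrow> clift A (X \<beta>) w (\<lambda>u. f (fst u)) = X \<beta> (fst w) f"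
    "smooth_near A (fst w) f \<Longrightarrow> clift A (X \<beta>) w (\<lambda>u. snd u f) = snd w (\<lambda>p. X \<beta> p f)"
    "fibre_part w (clift A (X \<beta>) w) =
      (\<lambda>f. \<Sum>\<gamma>\<in>UNIV. qv \<gamma> w * (cov \<gamma> \<beta> (fst w) f - cov \<beta> \<gamma> (fst w) f))"
    using Z fibre lifts by auto
qed

text \<open>The terms \<open>v\<^sup>\<gamma> g(\<nabla>\<^sup>g\<^sub>\<beta> X\<^sub>\<gamma>, v)\<close> that come from the bracket and from differentiating the
  metric cancel.\<close>
lemma clift_kinetic:
  assumes w: "w \<in> tangent_bundle A"
  shows "clift A (X \<beta>) w L = (\<Sum>\<gamma>\<in>UNIV. qv \<gamma> w * g (fst w) (cov \<gamma> \<beta> (fst w)) (snd w))"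
proof -
  let ?q = "fst w" and ?v = "snd w"
  note v = snd_tangent[OF w]
  have "g ?q (fibre_part w (clift A (X \<beta>) w)) ?v =
      (\<Sum>\<gamma>\<in>UNIV. qv \<gamma> w * g ?q (\<lambda>f. cov \<gamma> \<beta> ?q f - cov \<beta> \<gamma> ?q f) ?v)"
    unfolding clift_fibre_part[OF w]
    by (rule metric_sum[OF v connection_diff_tangent])
  also have "\<dots> = (\<Sum>\<gamma>\<in>UNIV. qv \<gamma> w * g ?q (cov \<gamma> \<beta> ?q) ?v) - (\<Sum>\<gamma>\<in>UNIV. qv \<gamma> w * g ?q (cov \<beta> \<gamma> ?q) ?v)"
    by (simp add: metric_diff[OF connection_tangent connection_tangent v] right_diff_distrib sum_subtractf)
  finally have fibre: "g ?q (fibre_part w (clift A (X \<beta>) w)) ?v = \<dots>" .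
  have "(\<Sum>\<delta>\<in>UNIV. \<Sum>\<alpha>\<in>UNIV. qv \<delta> w * qv \<alpha> w * X \<beta> ?q (metric_coeff \<alpha> \<delta>)) =
      (\<Sum>\<delta>\<in>UNIV. \<Sum>\<alpha>\<in>UNIV. qv \<alpha> w * (qv \<delta> w * g ?q (cov \<beta> \<alpha> ?q) (X \<delta> ?q))) +
      (\<Sum>\<delta>\<in>UNIV. \<Sum>\<alpha>\<in>UNIV. qv \<delta> w * (qv \<alpha> w * g ?q (X \<alpha> ?q) (cov \<beta> \<delta> ?q)))"
    by (simp add: metric_compatible sum.distrib algebra_simps)
  also have "(\<Sum>\<delta>\<in>UNIV. \<Sum>\<alpha>\<in>UNIV. qv \<alpha> w * (qv \<delta> w * g ?q (cov \<beta> \<alpha> ?q) (X \<delta> ?q))) =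
      (\<Sum>\<alpha>\<in>UNIV. qv \<alpha> w * g ?q (cov \<beta> \<alpha> ?q) ?v)"
    by (subst sum.swap)
      (simp add: sum_distrib_left[symmetric] metric_velocity(2)[OF w connection_tangent])
  also have "(\<Sum>\<delta>\<in>UNIV. \<Sum>\<alpha>\<in>UNIV. qv \<delta> w * (qv \<alpha> w * g ?q (X \<alpha> ?q) (cov \<beta> \<delta> ?q))) =
      (\<Sum>\<delta>\<in>UNIV. qv \<delta> w * g ?q (cov \<beta> \<delta> ?q) ?v)"
    by (simp add: sum_distrib_left[symmetric] metric_velocity(1)[OF w connection_tangent])
  finally show ?thesis
    using tangent_kinetic[OF w clift_tangent[OF w] clift_base[OF w], of \<beta>] fibre by simp
qed

subsection \<open>The Euler--Lagrange equations of the kinetic energy\<close>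

text \<open>The value at \<open>w\<close> of a second-order field whose forces at \<open>w\<close> are \<open>F\<close>. The
  equations below are pointwise, so they apply equally to fields that are defined on the
  constraint set only.\<close>
definition sode_vector where
  "sode_vector w F = (\<lambda>f. \<Sum>\<alpha>\<in>UNIV. qv \<alpha> w * clift A (X \<alpha>) w f + F \<alpha> * vlift A (X \<alpha> (fst w)) w f)"

text \<open>\<open>\<nabla>\<^sub>v v = v\<^sup>\<alpha> v\<^sup>\<beta> \<nabla>\<^sup>g\<^sub>\<alpha> X\<^sub>\<beta>\<close>, the covariant acceleration of a curve with velocity \<open>v\<close> and constant
  quasi-velocities.\<close>
definition acceleration where
  "acceleration w = (\<lambda>f. \<Sum>\<alpha>\<in>UNIV. qv \<alpha> w * (\<Sum>\<beta>\<in>UNIV. qv \<beta> w * cov \<alpha> \<beta> (fst w) f))"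

definition acceleration_coeff where
  "acceleration_coeff w \<gamma> =
     (\<Sum>\<alpha>\<in>UNIV. \<Sum>\<beta>\<in>UNIV. frame_coeff X (fst w) (cov \<alpha> \<beta> (fst w)) \<gamma> * qv \<alpha> w * qv \<beta> w)"

lemma connection_sum_tangent: "(\<lambda>f. \<Sum>\<beta>\<in>UNIV. c \<beta> * cov \<alpha> \<beta> q f) \<in> T q"
  by (intro tangent_sum_closed connection_tangent) (simp add: points_UNIV)

lemma acceleration_tangent: "acceleration w \<in> T (fst w)"
  unfolding acceleration_def
  by (rule tangent_sum_closed[OF _ connection_sum_tangent]) (simp add: points_UNIV)

lemma acceleration_expand: "acceleration w f = (\<Sum>\<gamma>\<in>UNIV. acceleration_coeff w \<gamma> * X \<gamma> (fst w) f)"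
proof -
  let ?c = "\<lambda>\<alpha> \<beta> \<gamma>. frame_coeff X (fst w) (cov \<alpha> \<beta> (fst w)) \<gamma>"
  have "acceleration w f =
      (\<Sum>\<alpha>\<in>UNIV. \<Sum>\<beta>\<in>UNIV. \<Sum>\<gamma>\<in>UNIV. ?c \<alpha> \<beta> \<gamma> * qv \<alpha> w * qv \<beta> w * X \<gamma> (fst w) f)"
    unfolding acceleration_def frame_expand[OF connection_tangent, of _ _ "fst w" f]
    by (simp add: sum_distrib_left mult_ac)
  also have "\<dots> = (\<Sum>\<alpha>\<in>UNIV. \<Sum>\<gamma>\<in>UNIV. \<Sum>\<beta>\<in>UNIV. ?c \<alpha> \<beta> \<gamma> * qv \<alpha> w * qv \<beta> w * X \<gamma> (fst w) f)"
    by (intro sum.cong[OF refl] sum.swap)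
  also have "\<dots> = (\<Sum>\<gamma>\<in>UNIV. \<Sum>\<alpha>\<in>UNIV. \<Sum>\<beta>\<in>UNIV. ?c \<alpha> \<beta> \<gamma> * qv \<alpha> w * qv \<beta> w * X \<gamma> (fst w) f)"
    by (rule sum.swap)
  finally show ?thesis by (simp add: acceleration_coeff_def sum_distrib_right)
qed

lemma sode_vector_tangent:
  assumes w: "w \<in> tangent_bundle A"
  shows "sode_vector w F \<in> TT w"
  unfolding sode_vector_def sum.distrib
  by (intro TQ.tangent_add_closed TQ.tangent_sum_closed clift_tangent vlift_tangent frame_tangent w)
    (simp_all add: points_tangent_atlas w)

lemma sode_vector_base:
  assumes w: "w \<in> tangent_bundle A" and f: "smooth_near A (fst w) f"
  shows "sode_vector w F (\<lambda>u. f (fst u)) = snd w f"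
  by (simp add: sode_vector_def clift_base[OF w f] vlift_base velocity_expand[OF w])

text \<open>Equivalently \<open>\<Gamma>(v\<^sup>\<alpha>) = F\<^sup>\<alpha>\<close>: the complete lifts contribute \<open>v\<^sup>\<alpha> v\<^sup>\<gamma> [X\<^sub>\<gamma>, X\<^sub>\<alpha>] = 0\<close>. Here this
  is read off from the action on differentials.\<close>
lemma sode_vector_fibre_part:
  assumes w: "w \<in> tangent_bundle A"
  shows "fibre_part w (sode_vector w F) = (\<lambda>f. \<Sum>\<alpha>\<in>UNIV. F \<alpha> * X \<alpha> (fst w) f)"
proof
  fix f
  show "fibre_part w (sode_vector w F) f = (\<Sum>\<alpha>\<in>UNIV. F \<alpha> * X \<alpha> (fst w) f)"
  proof (cases "smooth_near A (fst w) f")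
    case True
    have "sode_vector w F (\<lambda>u. snd u f) =
        (\<Sum>\<alpha>\<in>UNIV. qv \<alpha> w * snd w (\<lambda>p. X \<alpha> p f)) + (\<Sum>\<alpha>\<in>UNIV. F \<alpha> * X \<alpha> (fst w) f)"
      by (simp add: sode_vector_def clift_differential[OF w True] vlift_differential[OF w True] sum.distrib)
    then show ?thesis
      using tangent_differential[OF w sode_vector_tangent[OF w] sode_vector_base[OF w] True, of F] by simp
  qed (simp add: tangent_not_smooth[OF fibre_part_tangent] tangent_not_smooth[OF frame_sum_tangent])
qed

lemma sode_vector_quasi_velocity:
  assumes "w \<in> tangent_bundle A"
  shows "sode_vector w F (qv \<alpha>) = F \<alpha>"
proof -
  have "(\<lambda>\<alpha>. sode_vector w F (qv \<alpha>)) = frame_coeff X (fst w) (fibre_part w (sode_vector w F))"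
    unfolding fibre_part_def by (rule frame_coeff_sum[symmetric])
  also have "\<dots> = F"
    unfolding sode_vector_fibre_part[OF assms] by (rule frame_coeff_sum)
  finally show ?thesis by (rule fun_cong)
qed

text \<open>Metric compatibility splits the derivative of the metric coefficients along \<open>v\<close> into two
  sums: one is \<open>g(\<nabla>\<^sub>v v, X\<^sub>\<beta>)\<close>, the other is the complete lift of \<open>X\<^sub>\<beta>\<close> applied to \<open>L\<close>.\<close>
lemma euler_lagrange:
  assumes w: "w \<in> tangent_bundle A"
  shows "sode_vector w F (\<lambda>u. vlift A (X \<beta> (fst u)) u L) - clift A (X \<beta>) w L =
    g (fst w) (\<lambda>f. \<Sum>\<gamma>\<in>UNIV. (F \<gamma> + acceleration_coeff w \<gamma>) * X \<gamma> (fst w) f) (X \<beta> (fst w))"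
proof -
  let ?q = "fst w" and ?v = "snd w"
  have acc: "g ?q (acceleration w) (X \<beta> ?q) =
      (\<Sum>\<alpha>\<in>UNIV. qv \<alpha> w * (\<Sum>\<delta>\<in>UNIV. qv \<delta> w * g ?q (cov \<alpha> \<delta> ?q) (X \<beta> ?q)))"
    unfolding acceleration_def
    by (simp add: metric_sum[OF frame_tangent connection_sum_tangent] metric_sum[OF frame_tangent connection_tangent])
  have "sode_vector w F (\<lambda>u. vlift A (X \<beta> (fst u)) u L) = sode_vector w F (momentum \<beta>)"
    by (rule TQ.tangent_cong[OF sode_vector_tangent[OF w]]) (simp add: vlift_kinetic points_tangent_atlas)
  also have "\<dots> = g ?q (\<lambda>f. \<Sum>\<alpha>\<in>UNIV. F \<alpha> * X \<alpha> ?q f) (X \<beta> ?q) + (\<Sum>\<alpha>\<in>UNIV. qv \<alpha> w * ?v (metric_coeff \<alpha> \<beta>))"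
    using tangent_momentum[OF w sode_vector_tangent[OF w] sode_vector_base[OF w]]
    by (simp add: sode_vector_fibre_part[OF w])
  also have "(\<Sum>\<alpha>\<in>UNIV. qv \<alpha> w * ?v (metric_coeff \<alpha> \<beta>)) =
      (\<Sum>\<alpha>\<in>UNIV. \<Sum>\<delta>\<in>UNIV. qv \<delta> w * (qv \<alpha> w * g ?q (cov \<delta> \<alpha> ?q) (X \<beta> ?q))) +
      (\<Sum>\<alpha>\<in>UNIV. \<Sum>\<delta>\<in>UNIV. qv \<delta> w * (qv \<alpha> w * g ?q (X \<alpha> ?q) (cov \<delta> \<beta> ?q)))"
    by (simp add: velocity_expand[OF w] metric_compatible sum_distrib_left sum.distrib algebra_simps)
  also have "(\<Sum>\<alpha>\<in>UNIV. \<Sum>\<delta>\<in>UNIV. qv \<delta> w * (qv \<alpha> w * g ?q (cov \<delta> \<alpha> ?q) (X \<beta> ?q))) =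
      g ?q (acceleration w) (X \<beta> ?q)"
    unfolding acc by (subst sum.swap) (simp add: sum_distrib_left)
  also have "(\<Sum>\<alpha>\<in>UNIV. \<Sum>\<delta>\<in>UNIV. qv \<delta> w * (qv \<alpha> w * g ?q (X \<alpha> ?q) (cov \<delta> \<beta> ?q))) =
      clift A (X \<beta>) w L"
    by (subst sum.swap)
      (simp add: clift_kinetic[OF w] sum_distrib_left[symmetric] metric_velocity(1)[OF w connection_tangent])
  also have "g ?q (\<lambda>f. \<Sum>\<alpha>\<in>UNIV. F \<alpha> * X \<alpha> ?q f) (X \<beta> ?q) + (g ?q (acceleration w) (X \<beta> ?q) + clift A (X \<beta>) w L) =
      g ?q (\<lambda>f. (\<Sum>\<alpha>\<in>UNIV. F \<alpha> * X \<alpha> ?q f) + acceleration w f) (X \<beta> ?q) + clift A (X \<beta>) w L"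
    using metric_add[OF frame_sum_tangent acceleration_tangent frame_tangent] by simp
  finally show ?thesis
    by (simp add: acceleration_expand distrib_right sum.distrib)
qed

lemma geodesic_forces:
  assumes w: "w \<in> tangent_bundle A"
    and "\<And>\<beta>. sode_vector w F (\<lambda>u. vlift A (X \<beta> (fst u)) u L) - clift A (X \<beta>) w L = 0"
  shows "F = (\<lambda>\<gamma>. - acceleration_coeff w \<gamma>)"
proof -
  have "(\<lambda>f. \<Sum>\<gamma>\<in>UNIV. (F \<gamma> + acceleration_coeff w \<gamma>) * X \<gamma> (fst w) f) = (\<lambda>f. 0)"
    by (rule metric_frame_eq_zero[OF frame_sum_tangent]) (simp only: assms(2) euler_lagrange[OF w, symmetric])
  then have "(\<lambda>\<gamma>. F \<gamma> + acceleration_coeff w \<gamma>) = (\<lambda>\<gamma>. 0)"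
    using frame_coeff_sum[of "fst w" "\<lambda>\<gamma>. F \<gamma> + acceleration_coeff w \<gamma>"]
      frame_coeff_sum[of "fst w" "\<lambda>\<gamma>. 0"] by simp
  then show ?thesis by (simp add: fun_eq_iff eq_neg_iff_add_eq_0)
qed

lemma spray_sode_vector:
  "spray A X nab w = sode_vector w (\<lambda>\<gamma>. - (\<Sum>\<alpha>\<in>UNIV. \<Sum>\<beta>\<in>UNIV.
     frame_coeff X (fst w) (nab (X \<alpha>) (X \<beta>) (fst w)) \<gamma> * qv \<alpha> w * qv \<beta> w))"
  by (rule ext) (simp add: spray_def sode_vector_def sum.distrib sum_subtractf sum_distrib_right)

lemma spray_levi_civita: "spray A X nabg w = sode_vector w (\<lambda>\<gamma>. - acceleration_coeff w \<gamma>)"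
  unfolding spray_sode_vector acceleration_coeff_def ..

section \<open>The nonholonomic connection\<close>

text \<open>The upper index comes last: this is \<open>\<Gamma>\<^sup>\<gamma>\<^sub>\<alpha>\<^sub>\<beta>\<close> when applied to \<open>\<gamma>\<close>.\<close>
abbreviation "christoffel \<alpha> \<beta> q \<equiv> frame_coeff X q (cov \<alpha> \<beta> q)"

lemma distribution_span: "D q = frame_span X I q" "orth_complement A g D q = frame_span X (- I) q"
  using adapted points_UNIV by (simp_all add: adapted_frame_def)

lemma frame_span_tangent: "u \<in> frame_span X J q \<Longrightarrow> u \<in> T q"
  using frame_sum_tangent by (auto simp: frame_span_def)

lemma distribution_orthogonal:
  assumes "u \<in> frame_span X I q" "v \<in> frame_span X (- I) q"
  shows "g q u v = 0" "g q v u = 0"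
proof -
  show "g q v u = 0"
    using assms distribution_span[of q] by (auto simp: orth_complement_def)
  then show "g q u v = 0"
    using metric_sym[OF frame_span_tangent[OF assms(1)] frame_span_tangent[OF assms(2)]] by simp
qed

text \<open>The difference between a vector and its part in the span of the \<open>X\<^sub>\<alpha>\<close> with \<open>\<alpha> \<in> J\<close> lies in the span
  of the others, hence is orthogonal to \<open>S\<close>. Positivity of \<open>g\<close> makes such a part unique.\<close>
lemma orth_proj_frame_sum:
  assumes S: "S q = frame_span X J q"
    and orth: "\<And>u s. u \<in> frame_span X (- J) q \<Longrightarrow> s \<in> frame_span X J q \<Longrightarrow> g q u s = 0"
  shows "orth_proj g S q (\<lambda>f. \<Sum>\<alpha>\<in>UNIV. c \<alpha> * X \<alpha> q f) = (\<lambda>f. \<Sum>\<alpha>\<in>J. c \<alpha> * X \<alpha> q f)"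
proof -
  let ?u = "\<lambda>f. \<Sum>\<alpha>\<in>UNIV. c \<alpha> * X \<alpha> q f" and ?p = "\<lambda>f. \<Sum>\<alpha>\<in>J. c \<alpha> * X \<alpha> q f"
  have "?u f - ?p f = (\<Sum>\<alpha>\<in>- J. c \<alpha> * X \<alpha> q f)" for f
    by (simp add: Compl_eq_Diff_UNIV sum_diff)
  then have perp: "(\<lambda>f. ?u f - ?p f) \<in> frame_span X (- J) q"
    by (auto simp: frame_span_def)
  have span: "?p \<in> frame_span X J q" by (auto simp: frame_span_def)
  show ?thesis
    unfolding orth_proj_def
  proof (rule the_equality)
    show "?p \<in> S q \<and> (\<forall>s\<in>S q. g q (\<lambda>f. ?u f - ?p f) s = 0)"
      using span orth[OF perp] by (simp add: S)
    fix p assume p: "p \<in> S q \<and> (\<forall>s\<in>S q. g q (\<lambda>f. ?u f - p f) s = 0)"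
    then obtain d where d: "p = (\<lambda>f. \<Sum>\<alpha>\<in>J. d \<alpha> * X \<alpha> q f)" by (auto simp: S frame_span_def)
    let ?r = "\<lambda>f. p f - ?p f"
    have r_sum: "?r = (\<lambda>f. \<Sum>\<alpha>\<in>J. (d \<alpha> - c \<alpha>) * X \<alpha> q f)"
      by (simp add: d left_diff_distrib sum_subtractf)
    have r: "?r \<in> frame_span X J q"
      unfolding frame_span_def by (intro CollectI exI[of _ "\<lambda>\<alpha>. d \<alpha> - c \<alpha>"] conjI r_sum TrueI)
    have u_p: "(\<lambda>f. ?u f - p f) \<in> T q"
      using tangent_linear[where a = 1 and b = "-1", OF frame_sum_tangent frame_sum_tangent] by (simp add: d)
    have "g q (\<lambda>f. (?u f - ?p f) - (?u f - p f)) ?r = 0"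
      using metric_diff[OF frame_span_tangent[OF perp] u_p frame_span_tangent[OF r]] orth[OF perp r] p r S
      by simp
    then have "g q ?r ?r = 0" by simp
    then have "?r = (\<lambda>f. 0)" using metric_pos[OF frame_span_tangent[OF r]] by force
    then show "p = ?p" by (simp add: fun_eq_iff)
  qed
qed

lemma orth_proj_complement:
  "orth_proj g (orth_complement A g D) q (\<lambda>f. \<Sum>\<alpha>\<in>UNIV. c \<alpha> * X \<alpha> q f) = (\<lambda>f. \<Sum>\<alpha>\<in>- I. c \<alpha> * X \<alpha> q f)"
  by (rule orth_proj_frame_sum) (simp_all add: distribution_span distribution_orthogonal)

lemma orth_proj_distribution:
  "orth_proj g D q (\<lambda>f. \<Sum>\<alpha>\<in>UNIV. c \<alpha> * X \<alpha> q f) = (\<lambda>f. \<Sum>\<alpha>\<in>I. c \<alpha> * X \<alpha> q f)"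
  by (rule orth_proj_frame_sum) (simp_all add: distribution_span distribution_orthogonal)

lemma sum_delta_frame: "(\<Sum>\<alpha>\<in>J. (if \<alpha> = \<beta> then 1 else 0) * X \<alpha> q f) = (if \<beta> \<in> J then X \<beta> q f else 0)"
proof -
  have "(\<Sum>\<alpha>\<in>J. (if \<alpha> = \<beta> then 1 else 0) * X \<alpha> q f) = (\<Sum>\<alpha>\<in>J. if \<alpha> = \<beta> then X \<alpha> q f else 0)"
    by (intro sum.cong) auto
  then show ?thesis by (simp add: sum.delta)
qed

lemma frame_coeff_frame: "frame_coeff X q (X \<beta> q) = (\<lambda>\<alpha>. if \<alpha> = \<beta> then 1 else 0)"
  by (rule frame_coeff_eqI[OF frame_tangent]) (simp add: sum_delta_frame)

lemma orth_proj_frame: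
  "orth_proj g (orth_complement A g D) q (X \<beta> q) = (\<lambda>f. if \<beta> \<in> I then 0 else X \<beta> q f)"
proof -
  have "X \<beta> q = (\<lambda>f. \<Sum>\<alpha>\<in>UNIV. (if \<alpha> = \<beta> then 1 else 0) * X \<alpha> q f)"
    by (simp add: sum_delta_frame)
  then have "orth_proj g (orth_complement A g D) q (X \<beta> q) =
      (\<lambda>f. \<Sum>\<alpha>\<in>- I. (if \<alpha> = \<beta> then 1 else 0) * X \<alpha> q f)"
    using orth_proj_complement[of q "\<lambda>\<alpha>. if \<alpha> = \<beta> then 1 else 0"] by simp
  then show ?thesis by (cases "\<beta> \<in> I") (simp_all add: sum_delta_frame)
qed

text \<open>This is needed because \<open>Q(X\<^sub>\<beta>) = 0\<close> for \<open>\<beta> \<in> I\<close>. It is the product rule for a field multiplied by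
  the function 0.\<close>
lemma connection_zero: "nabg (X \<alpha>) (\<lambda>p f. 0) = (\<lambda>q f. 0)"
proof -
  have "smooth_fun A (\<lambda>q. 0)"
    using smooth_near_const by (simp add: smooth_fun_def)
  then have "nabg (X \<alpha>) (\<lambda>q f. 0 * X \<alpha> q f) = (\<lambda>q f. 0 * nabg (X \<alpha>) (X \<alpha>) q f + X \<alpha> q (\<lambda>q. 0) * X \<alpha> q f)"
    using connection frame_field unfolding linear_connection_def by blast
  then show ?thesis by (simp add: tangent_const[OF frame_tangent])
qed

lemma nonholonomic_coeff:
  "frame_coeff X q (nonholonomic_connection A g D nabg (X \<alpha>) (X \<beta>) q) \<gamma> =
    (if \<gamma> \<in> I then christoffel \<alpha> \<beta> q \<gamma> else 0) + (if \<beta> \<in> I then 0 else christoffel \<alpha> \<beta> q \<gamma>)"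
proof -
  let ?c = "christoffel \<alpha> \<beta> q"
  have N: "cov \<alpha> \<beta> q = (\<lambda>f. \<Sum>\<gamma>\<in>UNIV. ?c \<gamma> * X \<gamma> q f)"
    by (rule ext) (rule frame_expand[OF connection_tangent])
  have "orth_proj g D q (cov \<alpha> \<beta> q) = (\<lambda>f. \<Sum>\<gamma>\<in>I. ?c \<gamma> * X \<gamma> q f)"
    by (subst N) (rule orth_proj_distribution)
  moreover have "(\<Sum>\<gamma>\<in>I. ?c \<gamma> * X \<gamma> q f) = (\<Sum>\<gamma>\<in>UNIV. (if \<gamma> \<in> I then ?c \<gamma> else 0) * X \<gamma> q f)" for f
    by (rule sum.mono_neutral_cong_left) auto
  moreover have "nabg (X \<alpha>) (\<lambda>p. orth_proj g (orth_complement A g D) p (X \<beta> p)) q f =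
      (\<Sum>\<gamma>\<in>UNIV. (if \<beta> \<in> I then 0 else ?c \<gamma>) * X \<gamma> q f)" for f
    using fun_cong[OF N, of f] by (cases "\<beta> \<in> I") (simp_all add: orth_proj_frame connection_zero)
  ultimately have "nonholonomic_connection A g D nabg (X \<alpha>) (X \<beta>) q =
      (\<lambda>f. \<Sum>\<gamma>\<in>UNIV. ((if \<gamma> \<in> I then ?c \<gamma> else 0) + (if \<beta> \<in> I then 0 else ?c \<gamma>)) * X \<gamma> q f)"
    by (simp only: nonholonomic_connection_def distrib_right sum.distrib)
  then show ?thesis by (simp only: frame_coeff_sum)
qed

subsection \<open>Fields along the projection\<close>

lemma field_along_frame: "field_along A (\<lambda>u. X i (fst u))"
  using smooth_near_base[OF _ frame_smooth] by (simp add: field_along_def frame_tangent)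

lemma field_along_sum:
  assumes "\<And>i. i \<in> J \<Longrightarrow> field_along A (\<xi> i)"
    and "\<And>i. i \<in> J \<Longrightarrow> smooth_fun (tangent_atlas A) (h i)"
  shows "field_along A (\<lambda>u f. \<Sum>i\<in>J. h i u * \<xi> i u f)"
  unfolding field_along_def
proof (intro conjI ballI allI impI)
  fix w assume w: "w \<in> tangent_bundle A"
  show "(\<lambda>f. \<Sum>i\<in>J. h i w * \<xi> i w f) \<in> T (fst w)"
    using assms(1) w by (intro tangent_sum_closed) (auto simp: points_UNIV field_along_def)
  fix f assume "smooth_near A (fst w) f"
  then show "smooth_near (tangent_atlas A) w (\<lambda>u. \<Sum>i\<in>J. h i u * \<xi> i u f)"
    using assms w by (intro TQ.smooth_near_sum TQ.smooth_near_mult)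
      (auto simp: points_tangent_atlas field_along_def smooth_fun_def)
qed

lemma smooth_fun_quasi_velocity: "smooth_fun (tangent_atlas A) (qv \<alpha>)"
  using smooth_near_quasi_velocity by (simp add: smooth_fun_def points_tangent_atlas)

lemma sode_with_vector:
  "sode_with A X \<Gamma> F \<Longrightarrow> w \<in> tangent_bundle A \<Longrightarrow> \<Gamma> w = sode_vector w (\<lambda>\<alpha>. F \<alpha> w)"
  by (simp add: sode_with_def sode_vector_def)

end

locale kinetic_dynamics = adapted_geometry A g D I X nabg
  for A :: "('q::{t2_space, second_countable_topology}, real ^ 'n::finite) chart set"
    and g D I X nabg +
  fixes \<Gamma> :: "'q tpoint vfield"
    and nab :: "('q tpoint \<Rightarrow> 'q tvec) \<Rightarrow> ('q tpoint \<Rightarrow> 'q tvec)"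
  assumes lagrangian: "lagrangian_sode A X L \<Gamma>"
    and covariant: "dynamical_cov_deriv A X \<Gamma> nab"
begin

interpretation TQ: smooth_atlas "tangent_atlas A"
  by (rule smooth_atlas_tangent_atlas)

lemma force_acceleration:
  assumes "sode_with A X \<Gamma> F" "w \<in> tangent_bundle A"
  shows "F \<alpha> w = - acceleration_coeff w \<alpha>"
proof -
  have "(\<lambda>\<alpha>. F \<alpha> w) = (\<lambda>\<alpha>. - acceleration_coeff w \<alpha>)"
    using lagrangian frame_field assms(2) unfolding sode_with_vector[OF assms, symmetric] lagrangian_sode_def
    by (intro geodesic_forces[OF assms(2)]) (simp add: sode_with_vector[OF assms, symmetric])
  then show ?thesis by (rule fun_cong)
qed

lemma sode_geodesic:
  assumes "w \<in> tangent_bundle A"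
  shows "\<Gamma> w = sode_vector w (\<lambda>\<alpha>. - acceleration_coeff w \<alpha>)"
proof -
  obtain F where F: "sode_with A X \<Gamma> F"
    using lagrangian by (auto simp: lagrangian_sode_def sode_def)
  show ?thesis
    using sode_with_vector[OF F assms] force_acceleration[OF F assms] by simp
qed

text \<open>Along the line \<open>v + t X\<^sub>i\<close> in a fibre the force is a quadratic polynomial in \<open>t\<close>.\<close>
lemma vlift_force:
  assumes F: "sode_with A X \<Gamma> F" and w: "w \<in> tangent_bundle A"
  shows "vlift A (X i (fst w)) w (F \<gamma>) =
    - (\<Sum>\<alpha>\<in>UNIV. (christoffel i \<alpha> (fst w) \<gamma> + christoffel \<alpha> i (fst w) \<gamma>) * qv \<alpha> w)"
proof -
  let ?q = "fst w"
  let ?\<delta> = "\<lambda>\<alpha>. if \<alpha> = i then 1 else 0 :: real"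
  let ?u = "\<lambda>t. (?q, \<lambda>f. snd w f + t * X i ?q f)"
  have F_u: "F \<gamma> (?u t) =
      - (\<Sum>\<alpha>\<in>UNIV. \<Sum>\<beta>\<in>UNIV. christoffel \<alpha> \<beta> ?q \<gamma> * (qv \<alpha> w + t * ?\<delta> \<alpha>) * (qv \<beta> w + t * ?\<delta> \<beta>))" for t
  proof -
    have u: "?u t \<in> tangent_bundle A"
      using tangent_linear[OF snd_tangent[OF w] frame_tangent, of 1 t i] by (simp add: tangent_bundle_iff)
    have "qv \<alpha> (?u t) = qv \<alpha> w + t * ?\<delta> \<alpha>" for \<alpha>
      using fun_cong[OF frame_coeff_linear[OF snd_tangent[OF w] frame_tangent, of 1 t i], of \<alpha>]
      by (simp add: quasi_velocity_def frame_coeff_frame)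
    then show ?thesis
      by (simp only: force_acceleration[OF F u] acceleration_coeff_def fst_conv)
  qed
  have "((\<lambda>t. F \<gamma> (?u t)) has_field_derivative
      - (\<Sum>\<alpha>\<in>UNIV. \<Sum>\<beta>\<in>UNIV. christoffel \<alpha> \<beta> ?q \<gamma> * ?\<delta> \<alpha> * qv \<beta> w + christoffel \<alpha> \<beta> ?q \<gamma> * qv \<alpha> w * ?\<delta> \<beta>)) (at 0)"
    unfolding F_u by (rule derivative_eq_intros DERIV_sum refl | simp add: mult_ac)+
  moreover have "(\<Sum>\<alpha>\<in>UNIV. \<Sum>\<beta>\<in>UNIV. christoffel \<alpha> \<beta> ?q \<gamma> * ?\<delta> \<alpha> * qv \<beta> w + christoffel \<alpha> \<beta> ?q \<gamma> * qv \<alpha> w * ?\<delta> \<beta>) =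
      (\<Sum>\<alpha>\<in>UNIV. (christoffel i \<alpha> ?q \<gamma> + christoffel \<alpha> i ?q \<gamma>) * qv \<alpha> w)"
  proof -
    have "(\<Sum>\<alpha>\<in>UNIV. \<Sum>\<beta>\<in>UNIV. christoffel \<alpha> \<beta> ?q \<gamma> * ?\<delta> \<alpha> * qv \<beta> w) = (\<Sum>\<beta>\<in>UNIV. christoffel i \<beta> ?q \<gamma> * qv \<beta> w)"
      by (subst sum.swap) (simp add: if_distrib if_distribR sum.delta cong: if_cong)
    moreover have "(\<Sum>\<alpha>\<in>UNIV. \<Sum>\<beta>\<in>UNIV. christoffel \<alpha> \<beta> ?q \<gamma> * qv \<alpha> w * ?\<delta> \<beta>) = (\<Sum>\<alpha>\<in>UNIV. christoffel \<alpha> i ?q \<gamma> * qv \<alpha> w)"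
      by (simp add: if_distrib sum.delta cong: if_cong)
    ultimately show ?thesis by (simp only: sum.distrib distrib_right)
  qed
  moreover have "smooth_near (tangent_atlas A) w (F \<gamma>)"
    using F w by (simp add: sode_with_def smooth_fun_def points_tangent_atlas)
  ultimately show ?thesis
    using DERIV_imp_deriv by (simp add: vlift_def)
qed

lemma structure_fun_connection:
  "structure_fun A X \<gamma> \<alpha> \<beta> q = christoffel \<alpha> \<beta> q \<gamma> - christoffel \<beta> \<alpha> q \<gamma>"
  using fun_cong[OF frame_coeff_linear[where a = 1 and b = "-1", OF connection_tangent[of \<alpha> \<beta> q] connection_tangent[of \<beta> \<alpha> q]], of \<gamma>]
  by (simp add: structure_fun_def torsion_free)

text \<open>The symmetric part of the Christoffel symbols comes from the vertical derivative of the forces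
  and the skew part from the structure functions; the factor \<open>1/2\<close> makes them add up to the symbols
  themselves.\<close>
lemma covariant_frame:
  assumes w: "w \<in> tangent_bundle A"
  shows "nab (\<lambda>u. X i (fst u)) w = (\<lambda>f. \<Sum>\<gamma>\<in>UNIV. (\<Sum>\<alpha>\<in>UNIV. christoffel \<alpha> i (fst w) \<gamma> * qv \<alpha> w) * X \<gamma> (fst w) f)"
proof -
  obtain F where F: "sode_with A X \<Gamma> F"
    and nab: "nab (\<lambda>u. X i (fst u)) w = (\<lambda>f. \<Sum>\<beta>\<in>UNIV.
              - (1/2) * (vlift A (X i (fst w)) w (F \<beta>)
                  + (\<Sum>\<gamma>\<in>UNIV. qv \<gamma> w * structure_fun A X \<beta> i \<gamma> (fst w)))
              * X \<beta> (fst w) f)"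
    using covariant w unfolding dynamical_cov_deriv_def by blast
  have "- (1/2) * (vlift A (X i (fst w)) w (F \<beta>)
      + (\<Sum>\<gamma>\<in>UNIV. qv \<gamma> w * structure_fun A X \<beta> i \<gamma> (fst w))) =
      (\<Sum>\<alpha>\<in>UNIV. christoffel \<alpha> i (fst w) \<beta> * qv \<alpha> w)" for \<beta>
    by (simp add: vlift_force[OF F w] structure_fun_connection algebra_simps sum.distrib sum_subtractf)
  then show ?thesis unfolding nab by simp
qed

lemma covariant_zero:
  assumes w: "w \<in> tangent_bundle A"
  shows "nab (\<lambda>u f. 0) w = (\<lambda>f. 0)"
proof -
  have "field_along A (\<lambda>u f. 0)"
    using field_along_sum[of "{}"] by simp
  then have "nab (\<lambda>u f. 0 + 0) w = (\<lambda>f. nab (\<lambda>u f. 0) w f + nab (\<lambda>u f. 0) w f)"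
    using covariant w unfolding dynamical_cov_deriv_def by blast
  then show ?thesis by (simp add: fun_eq_iff)
qed

lemma covariant_field_along: "field_along A \<xi> \<Longrightarrow> field_along A (nab \<xi>)"
  using covariant by (simp add: dynamical_cov_deriv_def)

lemma covariant_add:
  "field_along A \<xi> \<Longrightarrow> field_along A \<eta> \<Longrightarrow> w \<in> tangent_bundle A \<Longrightarrow>
    nab (\<lambda>u f. \<xi> u f + \<eta> u f) w = (\<lambda>f. nab \<xi> w f + nab \<eta> w f)"
  using covariant by (simp add: dynamical_cov_deriv_def)

lemma covariant_mult:
  "smooth_fun (tangent_atlas A) h \<Longrightarrow> field_along A \<xi> \<Longrightarrow> w \<in> tangent_bundle A \<Longrightarrow>
    nab (\<lambda>u f. h u * \<xi> u f) w = (\<lambda>f. h w * nab \<xi> w f + \<Gamma> w h * \<xi> w f)"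
  using covariant by (simp add: dynamical_cov_deriv_def)

lemma covariant_sum:
  assumes w: "w \<in> tangent_bundle A"
  shows "nab (\<lambda>u f. \<Sum>i\<in>J. qv i u * X i (fst u) f) w =
    (\<lambda>f. \<Sum>i\<in>J. qv i w * nab (\<lambda>u. X i (fst u)) w f + \<Gamma> w (qv i) * X i (fst w) f)"
proof (induction J rule: infinite_finite_induct)
  case (insert i J)
  note fields = field_along_sum[OF field_along_frame smooth_fun_quasi_velocity]
  have "nab (\<lambda>u f. qv i u * X i (fst u) f + (\<Sum>i\<in>J. qv i u * X i (fst u) f)) w =
      (\<lambda>f. nab (\<lambda>u f. qv i u * X i (fst u) f) w f + nab (\<lambda>u f. \<Sum>i\<in>J. qv i u * X i (fst u) f) w f)"
    using fields[where J = "{i}"] fields[where J = J] by (intro covariant_add w) simp_all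
  then show ?case
    using insert covariant_mult[OF smooth_fun_quasi_velocity field_along_frame w] by simp
qed (simp_all add: covariant_zero[OF w])

text \<open>\<open>\<nabla>(Q(T))\<close>, which is the amount by which the forces of the projected field fall short of those
  of the geodesic spray.\<close>
definition reaction where
  "reaction = nab (\<lambda>u. orth_proj g (orth_complement A g D) (fst u) (canonical_field X u))"

text \<open>The second term comes from \<open>\<Gamma>(v\<^sup>i) = - (\<nabla>\<^sub>v v)\<^sup>i\<close> for \<open>i \<notin> I\<close>.\<close>
definition reaction_coeff where
  "reaction_coeff w \<gamma> = (\<Sum>i\<in>- I. \<Sum>\<alpha>\<in>UNIV. christoffel \<alpha> i (fst w) \<gamma> * qv \<alpha> w * qv i w)
     - (if \<gamma> \<in> I then 0 else acceleration_coeff w \<gamma>)"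

lemma reaction_eq: "reaction = nab (\<lambda>u f. \<Sum>i\<in>- I. qv i u * X i (fst u) f)"
  by (simp add: reaction_def canonical_field_def orth_proj_complement)

lemma field_along_reaction: "field_along A reaction"
  unfolding reaction_eq
  by (rule covariant_field_along[OF field_along_sum[OF field_along_frame smooth_fun_quasi_velocity]])

lemma reaction_expand:
  assumes w: "w \<in> tangent_bundle A"
  shows "reaction w = (\<lambda>f. \<Sum>\<gamma>\<in>UNIV. reaction_coeff w \<gamma> * X \<gamma> (fst w) f)"
proof
  fix f
  have "(\<Sum>i\<in>- I. qv i w * nab (\<lambda>u. X i (fst u)) w f) =
      (\<Sum>i\<in>- I. \<Sum>\<gamma>\<in>UNIV. (\<Sum>\<alpha>\<in>UNIV. christoffel \<alpha> i (fst w) \<gamma> * qv \<alpha> w * qv i w) * X \<gamma> (fst w) f)"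
    by (simp add: covariant_frame[OF w] sum_distrib_left sum_distrib_right mult_ac)
  also have "\<dots> = (\<Sum>\<gamma>\<in>UNIV. (\<Sum>i\<in>- I. \<Sum>\<alpha>\<in>UNIV. christoffel \<alpha> i (fst w) \<gamma> * qv \<alpha> w * qv i w) * X \<gamma> (fst w) f)"
    by (subst sum.swap) (simp add: sum_distrib_right)
  finally have 1: "(\<Sum>i\<in>- I. qv i w * nab (\<lambda>u. X i (fst u)) w f) = \<dots>" .
  have 2: "(\<Sum>i\<in>- I. \<Gamma> w (qv i) * X i (fst w) f) =
      (\<Sum>\<gamma>\<in>UNIV. (- (if \<gamma> \<in> I then 0 else acceleration_coeff w \<gamma>)) * X \<gamma> (fst w) f)"
    by (rule sum.mono_neutral_cong_left) (auto simp: sode_geodesic[OF w] sode_vector_quasi_velocity[OF w])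
  show "reaction w f = (\<Sum>\<gamma>\<in>UNIV. reaction_coeff w \<gamma> * X \<gamma> (fst w) f)"
    unfolding reaction_eq covariant_sum[OF w] sum.distrib 1 2 reaction_coeff_def
    by (simp add: left_diff_distrib sum_subtractf sum_negf)
qed

lemma projected_sode_reaction:
  "projected_sode A g D X \<Gamma> nab w = (\<lambda>f. \<Gamma> w f - vlift A (reaction w) w f)"
  by (rule ext) (simp add: projected_sode_def reaction_def)

lemma projected_sode_vector:
  assumes w: "w \<in> tangent_bundle A"
  shows "projected_sode A g D X \<Gamma> nab w =
    sode_vector w (\<lambda>\<gamma>. - acceleration_coeff w \<gamma> - reaction_coeff w \<gamma>)"
  unfolding projected_sode_reaction reaction_expand[OF w] vlift_sum[OF w frame_tangent] sode_geodesic[OF w]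
  by (simp add: sode_vector_def left_diff_distrib sum.distrib sum_subtractf sum_negf fun_eq_iff)

text \<open>In \<open>P(\<nabla>\<^sup>g\<^sub>\<alpha> X\<^sub>\<beta>) + \<nabla>\<^sup>g\<^sub>\<alpha> (Q(X\<^sub>\<beta>))\<close> the first term restricts the upper index of the Christoffel
  symbols to \<open>I\<close>, the second one the lower index \<open>\<beta>\<close> to its complement. Contracted with \<open>v\<^sup>\<alpha> v\<^sup>\<beta>\<close>
  they give the two terms of the forces.\<close>
lemma spray_nonholonomic:
  assumes w: "w \<in> tangent_bundle A"
  shows "spray A X (nonholonomic_connection A g D nabg) w = projected_sode A g D X \<Gamma> nab w"
proof -
  have "(\<Sum>\<alpha>\<in>UNIV. \<Sum>\<beta>\<in>UNIV.
      frame_coeff X (fst w) (nonholonomic_connection A g D nabg (X \<alpha>) (X \<beta>) (fst w)) \<gamma> * qv \<alpha> w * qv \<beta> w) =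
      acceleration_coeff w \<gamma> + reaction_coeff w \<gamma>" for \<gamma>
  proof -
    let ?c = "\<lambda>\<alpha> \<beta>. christoffel \<alpha> \<beta> (fst w) \<gamma> * qv \<alpha> w * qv \<beta> w"
    have "(\<Sum>i\<in>- I. \<Sum>\<alpha>\<in>UNIV. ?c \<alpha> i) = (\<Sum>i\<in>UNIV. \<Sum>\<alpha>\<in>UNIV. if i \<in> I then 0 else ?c \<alpha> i)"
      by (rule sum.mono_neutral_cong_left) auto
    also have "\<dots> = (\<Sum>\<alpha>\<in>UNIV. \<Sum>i\<in>UNIV. if i \<in> I then 0 else ?c \<alpha> i)"
      by (rule sum.swap)
    finally have compl: "(\<Sum>i\<in>- I. \<Sum>\<alpha>\<in>UNIV. ?c \<alpha> i) = \<dots>" .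
    have "(\<Sum>\<alpha>\<in>UNIV. \<Sum>\<beta>\<in>UNIV.
        frame_coeff X (fst w) (nonholonomic_connection A g D nabg (X \<alpha>) (X \<beta>) (fst w)) \<gamma> * qv \<alpha> w * qv \<beta> w) =
        (\<Sum>\<alpha>\<in>UNIV. \<Sum>\<beta>\<in>UNIV. (if \<gamma> \<in> I then ?c \<alpha> \<beta> else 0) + (if \<beta> \<in> I then 0 else ?c \<alpha> \<beta>))"
      unfolding nonholonomic_coeff by (intro sum.cong refl) (simp add: distrib_right)
    also have "\<dots> = (if \<gamma> \<in> I then acceleration_coeff w \<gamma> else 0) + (\<Sum>i\<in>- I. \<Sum>\<alpha>\<in>UNIV. ?c \<alpha> i)"
      unfolding compl by (simp add: sum.distrib acceleration_coeff_def)
    finally show ?thesis by (simp add: reaction_coeff_def)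
  qed
  then show ?thesis
    unfolding spray_sode_vector projected_sode_vector[OF w] by (simp add: algebra_simps)
qed

lemma sode_projected_sode: "sode A X (projected_sode A g D X \<Gamma> nab)"
proof -
  let ?P = "projected_sode A g D X \<Gamma> nab"
  obtain F where F: "sode_with A X \<Gamma> F"
    using lagrangian by (auto simp: lagrangian_sode_def sode_def)
  have "vector_field (tangent_atlas A) ?P"
    unfolding vector_field_def points_tangent_atlas
  proof (intro conjI ballI allI impI)
    fix w assume w: "w \<in> tangent_bundle A"
    show "?P w \<in> TT w" unfolding projected_sode_vector[OF w] by (rule sode_vector_tangent[OF w])
    fix f assume f: "smooth_near (tangent_atlas A) w f"
    have "smooth_near (tangent_atlas A) w (\<lambda>x. \<Gamma> x f)"
      using F w f by (simp add: sode_with_def vector_field_def points_tangent_atlas)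
    then show "smooth_near (tangent_atlas A) w (\<lambda>x. ?P x f)"
      unfolding projected_sode_reaction
      by (intro TQ.smooth_near_diff smooth_near_vlift[OF w field_along_reaction f])
  qed
  moreover have "smooth_fun (tangent_atlas A) (\<lambda>w. F \<gamma> w - frame_coeff X (fst w) (reaction w) \<gamma>)" for \<gamma>
    using F by (auto simp: smooth_fun_def sode_with_def points_tangent_atlas
        intro!: TQ.smooth_near_diff smooth_near_frame_coeff[OF _ field_along_reaction])
  moreover have "?P w = sode_vector w (\<lambda>\<gamma>. F \<gamma> w - frame_coeff X (fst w) (reaction w) \<gamma>)"
    if w: "w \<in> tangent_bundle A" for w
    unfolding projected_sode_vector[OF w] force_acceleration[OF F w] reaction_expand[OF w] frame_coeff_sum ..
  ultimately have "sode_with A X ?P (\<lambda>\<gamma> w. F \<gamma> w - frame_coeff X (fst w) (reaction w) \<gamma>)"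
    by (simp add: sode_with_def sode_vector_def)
  then show ?thesis by (auto simp: sode_def)
qed

text \<open>At a point of the constraint set the nonholonomic field has some forces \<open>G\<close> along \<open>D\<close>. Its
  equations make \<open>G\<^sup>\<gamma> X\<^sub>\<gamma> + \<nabla>\<^sub>v v\<close> orthogonal to \<open>D\<close>, so this vector has no components in \<open>I\<close> and
  \<open>G\<close> is the \<open>D\<close>-part of \<open>- \<nabla>\<^sub>v v\<close>. The projected field has the same forces there, since the first
  term of the reaction is linear in the \<open>v\<^sup>i\<close> with \<open>i \<notin> I\<close>.\<close>
lemma projected_sode_on_constraint:
  assumes nonhol: "nonholonomic_field A X D I L \<Gamma>\<^sub>D" and w: "w \<in> constraint_set A X I"
  shows "projected_sode A g D X \<Gamma> nab w = \<Gamma>\<^sub>D w"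
proof -
  let ?q = "fst w"
  have wT: "w \<in> tangent_bundle A" and qv: "\<And>i. i \<notin> I \<Longrightarrow> qv i w = 0"
    using w by (auto simp: constraint_set_def)
  obtain F where "\<forall>w\<in>constraint_set A X I. \<Gamma>\<^sub>D w =
      (\<lambda>f. \<Sum>a\<in>I. qv a w * clift A (X a) w f + F a w * vlift A (X a (fst w)) w f)"
    using nonhol unfolding nonholonomic_field_def by (elim conjE exE) (erule that)
  then have F: "\<Gamma>\<^sub>D w = (\<lambda>f. \<Sum>a\<in>I. qv a w * clift A (X a) w f + F a w * vlift A (X a ?q) w f)"
    using w by (rule bspec)
  have EL: "\<forall>Y. vector_field A Y \<longrightarrow> (\<forall>q\<in>points A. Y q \<in> D q) \<longrightarrow> (\<forall>w\<in>constraint_set A X I.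
      \<Gamma>\<^sub>D w (\<lambda>u. vlift A (Y (fst u)) u L) - clift A Y w L = 0)"
    using nonhol unfolding nonholonomic_field_def by (elim conjE)
  define G where "G \<gamma> = (if \<gamma> \<in> I then F \<gamma> w else 0)" for \<gamma>
  have \<Gamma>D: "\<Gamma>\<^sub>D w = sode_vector w G"
    unfolding F sode_vector_def by (intro ext sum.mono_neutral_cong_left) (auto simp: G_def qv)
  define c where "c \<gamma> = G \<gamma> + acceleration_coeff w \<gamma>" for \<gamma>
  have perp: "g ?q (\<lambda>f. \<Sum>\<gamma>\<in>UNIV. c \<gamma> * X \<gamma> ?q f) (X \<beta> ?q) = 0" if "\<beta> \<in> I" for \<beta>
  proof -
    have "X \<beta> q \<in> D q" for q
      unfolding distribution_span frame_span_def
      by (intro CollectI exI[of _ "\<lambda>\<alpha>. if \<alpha> = \<beta> then 1 else 0"]) (simp add: sum_delta_frame that)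
    then have "\<Gamma>\<^sub>D w (\<lambda>u. vlift A (X \<beta> (fst u)) u L) - clift A (X \<beta>) w L = 0"
      using EL[rule_format, OF frame_field _ w] by simp
    then show ?thesis using euler_lagrange[OF wT, of G \<beta>] by (simp add: \<Gamma>D c_def)
  qed
  have "(\<lambda>f. \<Sum>\<gamma>\<in>UNIV. c \<gamma> * X \<gamma> ?q f) \<in> orth_complement A g D ?q"
    unfolding orth_complement_def
  proof (intro CollectI conjI ballI frame_sum_tangent)
    fix s assume "s \<in> D ?q"
    then obtain d where s: "s = (\<lambda>f. \<Sum>\<alpha>\<in>I. d \<alpha> * X \<alpha> ?q f)"
      by (auto simp: distribution_span frame_span_def)
    have "g ?q s (\<lambda>f. \<Sum>\<gamma>\<in>UNIV. c \<gamma> * X \<gamma> ?q f) = 0"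
      unfolding s metric_sum[OF frame_sum_tangent frame_tangent]
      using perp metric_sym[OF frame_tangent frame_sum_tangent] by (intro sum.neutral) simp
    then show "g ?q (\<lambda>f. \<Sum>\<gamma>\<in>UNIV. c \<gamma> * X \<gamma> ?q f) s = 0"
      using metric_sym[OF frame_sum_tangent frame_sum_tangent] by (simp add: s)
  qed
  then obtain d where d: "(\<lambda>f. \<Sum>\<gamma>\<in>UNIV. c \<gamma> * X \<gamma> ?q f) = (\<lambda>f. \<Sum>\<gamma>\<in>- I. d \<gamma> * X \<gamma> ?q f)"
    by (auto simp: distribution_span frame_span_def)
  have "(\<Sum>\<gamma>\<in>- I. d \<gamma> * X \<gamma> ?q f) = (\<Sum>\<gamma>\<in>UNIV. (if \<gamma> \<in> I then 0 else d \<gamma>) * X \<gamma> ?q f)" for f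
    by (rule sum.mono_neutral_cong_left) auto
  then have "c = (\<lambda>\<gamma>. if \<gamma> \<in> I then 0 else d \<gamma>)"
    using frame_coeff_sum[of ?q c] d by (simp only: frame_coeff_sum)
  then have "G \<gamma> = - acceleration_coeff w \<gamma>" if "\<gamma> \<in> I" for \<gamma>
    using that c_def[of \<gamma>] by simp
  then have "G = (\<lambda>\<gamma>. - acceleration_coeff w \<gamma> - reaction_coeff w \<gamma>)"
    by (auto simp: reaction_coeff_def qv G_def fun_eq_iff)
  then show ?thesis by (simp add: projected_sode_vector[OF wT] \<Gamma>D)
qed

end

theorem proposition3:
  fixes A :: "('q::{t2_space, second_countable_topology}, real ^ 'n::finite) chart set"
    and g :: "'q metric"
    and D :: "'q \<Rightarrow> 'q tvec set"
    and I :: "'n set"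
    and X :: "'n \<Rightarrow> 'q vfield"
    and nabg :: "'q connection"
    and \<Gamma>\<^sub>L \<Gamma>\<^sub>D :: "'q tpoint vfield"
    and nab :: "('q tpoint \<Rightarrow> 'q tvec) \<Rightarrow> ('q tpoint \<Rightarrow> 'q tvec)"
  assumes "smooth_manifold A"
    and "riemannian_metric A g"
    and "adapted_frame A g D I X"
    and "levi_civita A g nabg"
    and "lagrangian_sode A X (kinetic_lagrangian g) \<Gamma>\<^sub>L"
    and "nonholonomic_field A X D I (kinetic_lagrangian g) \<Gamma>\<^sub>D"
    and "dynamical_cov_deriv A X \<Gamma>\<^sub>L nab"
  shows "(\<forall>w\<in>tangent_bundle A. \<Gamma>\<^sub>L w = spray A X nabg w) \<and>
    (\<forall>w\<in>tangent_bundle A.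
       spray A X (nonholonomic_connection A g D nabg) w = projected_sode A g D X \<Gamma>\<^sub>L nab w) \<and>
    sode_extension A X I (projected_sode A g D X \<Gamma>\<^sub>L nab) \<Gamma>\<^sub>D"
proof -
  interpret kinetic_dynamics A g D I X nabg \<Gamma>\<^sub>L nab
    using assms by unfold_locales
  show ?thesis
    unfolding sode_extension_def
    using sode_geodesic spray_levi_civita spray_nonholonomic sode_projected_sode
      projected_sode_on_constraint[OF assms(6)] by simp
qed

end
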